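(* There exist absolute constants $c,C>0$ such that the following holds. Let $G$ be an abelian group of order $N$ and let $S$ be a uniformly random subset of $G$. Then, with probability tending to $1$ as $N\to\infty$: (1) $S$ cannot be expressed as a union of fewer than $cN/(\log^2 N\,\log\log N)$ sumsets; and (2) $S$ is a union of at most $C N\log\log N/\log^2 N$ sumsets.
   Context: In this statement a sumset in $G$ is a set of the form $A+A=\{a+b : a,b\in A,\ a\neq b\}$ for some $A\subseteq G$ (only sums of distinct elements are included).
   Formalization: If 2g=0 for every g in G, then 0 lies in no sumset of distinct elements, so (2) fails with probability 1/2; for these groups (2) is stated for S without 0. Groups are taken with elements in the natural numbers, which covers every finite abelian group up to isomorphism. *)

theory Defs
  imports "HOL-Algebra.Coset" "HOL-Probability.Probability"
begin

text \<open>Groups are written multiplicatively, following HOL-Algebra. Only products of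
  distinct elements enter a sumset.\<close>

definition sumset :: "('a, 'b) monoid_scheme \<Rightarrow> 'a set \<Rightarrow> 'a set" where
  "sumset G A = {a \<otimes>\<^bsub>G\<^esub> b | a b. a \<in> A \<and> b \<in> A \<and> a \<noteq> b}"

text \<open>The \<open>m\<close> sumsets need not be distinct, and \<open>A i\<close> may be empty, so this says the same
  as being a union of at most \<open>m\<close> sumsets.\<close>

definition union_of_sumsets :: "('a, 'b) monoid_scheme \<Rightarrow> nat \<Rightarrow> 'a set \<Rightarrow> bool" where
  "union_of_sumsets G m S \<longleftrightarrow>
     (\<exists>A :: nat \<Rightarrow> 'a set. (\<forall>i<m. A i \<subseteq> carrier G) \<and> S = (\<Union>i<m. sumset G (A i)))"

text \<open>In a group of exponent at most 2 the identity is in no sumset. A random subset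
  contains the identity with probability 1/2, and is then not a union of sumsets at all, so
  in these groups an upper bound can only be asked for the subset without the identity.\<close>

lemma one_notin_sumset:
  assumes "comm_group G" "\<forall>g\<in>carrier G. g \<otimes>\<^bsub>G\<^esub> g = \<one>\<^bsub>G\<^esub>" "A \<subseteq> carrier G"
  shows "\<one>\<^bsub>G\<^esub> \<notin> sumset G A"
proof
  interpret comm_group G by fact
  assume "\<one>\<^bsub>G\<^esub> \<in> sumset G A"
  then obtain a b where ab: "a \<in> A" "b \<in> A" "a \<noteq> b" "a \<otimes>\<^bsub>G\<^esub> b = \<one>\<^bsub>G\<^esub>"
    unfolding sumset_def by auto
  then have "a \<otimes>\<^bsub>G\<^esub> b = a \<otimes>\<^bsub>G\<^esub> a" "a \<in> carrier G" "b \<in> carrier G"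
    using assms by auto
  then show False using ab(3) by simp
qed

lemma not_union_of_sumsets_if_one_mem:
  assumes "comm_group G" "\<forall>g\<in>carrier G. g \<otimes>\<^bsub>G\<^esub> g = \<one>\<^bsub>G\<^esub>" "\<one>\<^bsub>G\<^esub> \<in> S"
  shows "\<not> union_of_sumsets G m S"
  using one_notin_sumset[OF assms(1,2)] assms(3) unfolding union_of_sumsets_def by blast

text \<open>In every other abelian group each singleton is a sumset, so no such obstruction exists.\<close>

lemma singleton_sumset:
  assumes "comm_group G" "g \<in> carrier G" "g \<otimes>\<^bsub>G\<^esub> g \<noteq> \<one>\<^bsub>G\<^esub>" "x \<in> carrier G"
  shows "\<exists>A\<subseteq>carrier G. sumset G A = {x}"
proof -
  interpret comm_group G by fact
  have main: "\<exists>A\<subseteq>carrier G. sumset G A = {x}"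
    if a: "a \<in> carrier G" "a \<otimes>\<^bsub>G\<^esub> a \<noteq> x" for a
  proof -
    let ?b = "inv\<^bsub>G\<^esub> a \<otimes>\<^bsub>G\<^esub> x"
    have b1: "?b \<in> carrier G" "a \<otimes>\<^bsub>G\<^esub> ?b = x"
      using a assms(4) by (simp_all add: m_assoc[symmetric])
    moreover have "?b \<otimes>\<^bsub>G\<^esub> a = x"
      using b1 a m_comm[of ?b a] by simp
    ultimately have b: "?b \<in> carrier G" "a \<otimes>\<^bsub>G\<^esub> ?b = x" "?b \<otimes>\<^bsub>G\<^esub> a = x"
      by blast+
    have "a \<noteq> ?b" using a b by metis
    moreover have "sumset G {a, b} = {a \<otimes>\<^bsub>G\<^esub> b, b \<otimes>\<^bsub>G\<^esub> a}" if "a \<noteq> b" for b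
      using that unfolding sumset_def by blast
    ultimately have "sumset G {a, ?b} = {x}"
      using b by simp
    then show ?thesis using a b by (intro exI[of _ "{a, ?b}"]) simp
  qed
  show ?thesis
  proof (cases "x = \<one>\<^bsub>G\<^esub>")
    case True
    then show ?thesis using main[of g] assms by auto
  next
    case False
    then show ?thesis using main[of "\<one>\<^bsub>G\<^esub>"] by auto
  qed
qed

text \<open>A formula cannot quantify over types, so absolute constants valid for all finite abelian
  groups require one fixed carrier type. With \<open>nat\<close> this loses nothing: every finite abelian
  group has a copy there, and an isomorphism preserves random subsets and unions of sumsets.\<close>

lemma finite_comm_group_nat_copy:
  fixes G :: "'a monoid"
  assumes "comm_group G" "finite (carrier G)"
  obtains H :: "nat monoid" and h where "comm_group H" "h \<in> iso G H"
proof -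
  interpret comm_group G by fact
  obtain h where h: "bij_betw h (carrier G) {0..<card (carrier G)}"
    using ex_bij_betw_finite_nat[OF assms(2)] by blast
  let ?k = "inv_into (carrier G) h"
  define H :: "nat monoid" where
    "H = \<lparr>carrier = {0..<card (carrier G)}, monoid.mult = \<lambda>x y. h (?k x \<otimes>\<^bsub>G\<^esub> ?k y), one = h \<one>\<^bsub>G\<^esub>\<rparr>"
  have k: "?k (h x) = x" if "x \<in> carrier G" for x
    using h that by (simp add: bij_betw_inv_into_left)
  have hom: "h \<in> hom G H"
    using h k by (auto simp: hom_def H_def bij_betw_def)
  moreover have "bij_betw h (carrier G) (carrier H)"
    using h by (simp add: H_def)
  ultimately have iso: "h \<in> iso G H" by (simp add: iso_def)
  have "comm_group (H\<lparr>one := h \<one>\<^bsub>G\<^esub>\<rparr>)"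
    by (rule iso_imp_img_comm_group[OF iso])
  moreover have "H\<lparr>one := h \<one>\<^bsub>G\<^esub>\<rparr> = H" by (simp add: H_def)
  ultimately show thesis using iso that by simp
qed

lemma sumset_iso_image:
  assumes "h \<in> iso G H" "A \<subseteq> carrier G"
  shows "sumset H (h ` A) = h ` sumset G A"
proof -
  have mult: "h (a \<otimes>\<^bsub>G\<^esub> b) = h a \<otimes>\<^bsub>H\<^esub> h b" if "a \<in> A" "b \<in> A" for a b
    using assms that by (auto simp: iso_def hom_def)
  have inj: "h a = h b \<longleftrightarrow> a = b" if "a \<in> A" "b \<in> A" for a b
    using assms that by (auto simp: iso_def bij_betw_def inj_on_def)
  show ?thesis
  proof (intro equalityI subsetI)
    fix y assume "y \<in> sumset H (h ` A)"
    then obtain a b where "a \<in> A" "b \<in> A" "a \<noteq> b" "y = h a \<otimes>\<^bsub>H\<^esub> h b"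
      unfolding sumset_def by auto
    then show "y \<in> h ` sumset G A"
      unfolding sumset_def using mult by (auto intro!: image_eqI[where x = "a \<otimes>\<^bsub>G\<^esub> b"])
  next
    fix y assume "y \<in> h ` sumset G A"
    then obtain a b where "a \<in> A" "b \<in> A" "a \<noteq> b" "y = h (a \<otimes>\<^bsub>G\<^esub> b)"
      unfolding sumset_def by auto
    then show "y \<in> sumset H (h ` A)"
      unfolding sumset_def using mult inj by blast
  qed
qed

lemma union_of_sumsets_iso_image:
  assumes "group G" "h \<in> iso G H" "S \<subseteq> carrier G"
  shows "union_of_sumsets H m (h ` S) \<longleftrightarrow> union_of_sumsets G m S"
proof
  assume "union_of_sumsets G m S"
  then obtain A where A: "\<forall>i<m. A i \<subseteq> carrier G" "S = (\<Union>i<m. sumset G (A i))"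
    unfolding union_of_sumsets_def by auto
  have "h ` S = (\<Union>i<m. sumset H (h ` A i))"
    unfolding A(2) image_UN using A(1) assms(2) by (simp add: sumset_iso_image)
  moreover have "\<forall>i<m. h ` A i \<subseteq> carrier H"
    using A(1) assms(2) by (auto simp: iso_def bij_betw_def)
  ultimately show "union_of_sumsets H m (h ` S)"
    unfolding union_of_sumsets_def by (intro exI[of _ "\<lambda>i. h ` A i"] conjI)
next
  interpret group G by fact
  assume "union_of_sumsets H m (h ` S)"
  then obtain B where B: "\<forall>i<m. B i \<subseteq> carrier H" "h ` S = (\<Union>i<m. sumset H (B i))"
    unfolding union_of_sumsets_def by auto
  have inj: "inj_on h (carrier G)" and im: "h ` carrier G = carrier H"
    using assms(2) by (auto simp: iso_def bij_betw_def)
  let ?A = "\<lambda>i. {a \<in> carrier G. h a \<in> B i}"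
  have img: "h ` ?A i = B i" if "i < m" for i
  proof -
    have "B i \<subseteq> h ` carrier G" using B(1) im that by simp
    then show ?thesis by auto
  qed
  have "h ` S = (\<Union>i<m. sumset H (h ` ?A i))"
    unfolding B(2) by (intro SUP_cong) (simp_all only: img lessThan_iff)
  also have "\<dots> = (\<Union>i<m. h ` sumset G (?A i))"
    using assms(2) by (intro SUP_cong refl sumset_iso_image) auto
  also have "\<dots> = h ` (\<Union>i<m. sumset G (?A i))" by blast
  finally have "h ` S = h ` (\<Union>i<m. sumset G (?A i))" .
  moreover have "(\<Union>i<m. sumset G (?A i)) \<subseteq> carrier G"
    unfolding sumset_def by auto
  ultimately have "S = (\<Union>i<m. sumset G (?A i))"
    using inj assms(3) by (simp only: inj_on_image_eq_iff)
  then show "union_of_sumsets G m S"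
    unfolding union_of_sumsets_def by (intro exI[of _ ?A]) auto
qed

lemma random_subset_iso_image:
  assumes "finite (carrier G)" "h \<in> iso G H"
  shows "map_pmf (image h) (pmf_of_set (Pow (carrier G))) = pmf_of_set (Pow (carrier H))"
proof (rule map_pmf_of_set_bij_betw)
  show "bij_betw (image h) (Pow (carrier G)) (Pow (carrier H))"
    using assms(2) by (intro bij_betw_Pow) (simp add: iso_def)
qed (use assms in auto)

end

theory Submission
  imports Defs "HOL-Real_Asymp.Real_Asymp"
begin

text \<open>Write \<open>L = ln N\<close> and \<open>l = ln L\<close>.

  Lower bound: with high probability every sumset contained in \<open>S\<close> has size \<open>O(L\<^sup>2 l)\<close>, while \<open>|S|\<close> is
  about \<open>N / 2\<close>. A union bound excludes all nonempty \<open>B\<close> with \<open>B + B \<subseteq> S\<close> and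
  \<open>|B + B| \<ge> 5 L |B|\<close>. A greedy choice of about \<open>20 L\<close> elements then bounds \<open>|A|\<close> by \<open>O(L\<^sup>2)\<close> whenever
  \<open>A + A \<subseteq> S\<close>. Moreover such an \<open>A\<close> has a subset \<open>B\<close> of size \<open>O(L)\<close> such that every other \<open>a \<in> A\<close> has
  at least half of \<open>a + B\<close> inside \<open>B + B\<close>; there are only \<open>O(|B|\<^sup>2)\<close> such \<open>a\<close>, so once \<open>B\<close> is chosen each
  element of \<open>A\<close> costs a factor \<open>L ^ O(1)\<close> instead of \<open>N\<close>, and a second union bound shows
  \<open>|A + A| = O(L\<^sup>2 l)\<close>.

  Upper bound: by the bounded differences inequality every set \<open>A\<close> of size at most \<open>k = L / 10\<close> has
  \<open>(1 + O(1 / k)) N / 2 ^ |A|\<close> elements \<open>y\<close> with \<open>y + A \<subseteq> S\<close>. Counting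
  extensions, each \<open>x \<in> S\<close> is a sum in a proportion of order \<open>k\<^sup>2 / N\<close> of the sets \<open>A\<close> of size \<open>k\<close> with
  distinct pairwise sums and \<open>A + A \<subseteq> S\<close>. Hence some \<open>A + A\<close> covers that proportion of any prescribed
  subset of \<open>S\<close>; after \<open>O(N l / L\<^sup>2)\<close> greedy steps at most \<open>N / L\<^sup>2\<close> elements remain, which are covered
  by singletons.\<close>

section \<open>Random subsets of a finite set\<close>

text \<open>A set of size n + 1 arises from one of size n by inserting one of |X| elements, and
  smaller sets are already counted, so each unit of size costs a factor |X| + 1.\<close>

lemma card_subsets_card_le:
  assumes "finite X"
  shows "card {A. A \<subseteq> X \<and> card A \<le> n} \<le> (card X + 1) ^ n"
proof (induction n)
  case 0
  have "{A. A \<subseteq> X \<and> card A \<le> 0} = {{}}"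
    using assms by (auto dest: finite_subset)
  then show ?case by simp
next
  case (Suc n)
  let ?F = "{A. A \<subseteq> X \<and> card A \<le> n}"
  have fin: "finite ?F" using assms by (auto intro: finite_subset[of _ "Pow X"])
  have "{A. A \<subseteq> X \<and> card A \<le> Suc n} \<subseteq> ?F \<union> (\<lambda>(x, A). insert x A) ` (X \<times> ?F)"
  proof
    fix A assume A: "A \<in> {A. A \<subseteq> X \<and> card A \<le> Suc n}"
    show "A \<in> ?F \<union> (\<lambda>(x, A). insert x A) ` (X \<times> ?F)"
    proof (cases "card A \<le> n")
      case False
      then obtain x where x: "x \<in> A" by fastforce
      have "A = insert x (A - {x})" "card (A - {x}) \<le> n"
        using x A by (auto simp: card_Diff_singleton)
      then show ?thesis using A x
        by (intro UnI2 image_eqI[where x = "(x, A - {x})"]) auto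
    qed (use A in auto)
  qed
  then have "card {A. A \<subseteq> X \<and> card A \<le> Suc n} \<le> card (?F \<union> (\<lambda>(x, A). insert x A) ` (X \<times> ?F))"
    using fin assms by (intro card_mono) auto
  also have "\<dots> \<le> card ?F + card ((\<lambda>(x, A). insert x A) ` (X \<times> ?F))"
    by (rule card_Un_le)
  also have "\<dots> \<le> card ?F + card (X \<times> ?F)"
    using fin assms by (intro add_left_mono card_image_le) auto
  also have "\<dots> = (card X + 1) * card ?F" by (simp add: card_cartesian_product)
  also have "\<dots> \<le> (card X + 1) * (card X + 1) ^ n"
    using Suc by (rule mult_left_mono) simp
  finally show ?case by simp
qed

section \<open>Exponential moments under bounded differences\<close>

lemma sum_Pow_insert:
  assumes "finite F" "z \<notin> F"
  shows "(\<Sum>S\<in>Pow (insert z F). f S) = (\<Sum>S\<in>Pow F. f S + f (insert z S))"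
proof -
  have inj: "inj_on (insert z) (Pow F)"
    using assms(2) by (intro inj_onI) (auto dest: insert_ident)
  have "(\<Sum>S\<in>Pow (insert z F). f S) = (\<Sum>S\<in>Pow F. f S) + (\<Sum>S\<in>insert z ` Pow F. f S)"
    unfolding Pow_insert using assms by (intro sum.union_disjoint) auto
  then show ?thesis by (simp add: sum.reindex[OF inj] sum.distrib)
qed

text \<open>Hoeffding's lemma for a fair coin. The estimate with success probability 1/2 treats the
  values 0 and v - u; multiplying by exp u moves them to \<open>u\<close> and \<open>v\<close>, and
  symmetry allows u <= v.\<close>

lemma exp_add_exp_le:
  fixes u v c :: real
  assumes "\<bar>u - v\<bar> \<le> c"
  shows "exp u + exp v \<le> 2 * exp ((u + v) / 2) * exp (c\<^sup>2 / 8)"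
proof -
  have main: "exp u + exp v \<le> 2 * exp ((u + v) / 2) * exp (c\<^sup>2 / 8)"
    if "u \<le> v" "v - u \<le> c" for u v :: real
  proof -
    let ?h = "v - u"
    have "- ?h / 2 + ln ((1 + exp ?h) / 2) \<le> ?h\<^sup>2 / 8"
      using Hoeffdings_lemma_aux[of ?h "1 / 2"] that by (simp add: field_simps)
    also have "\<dots> \<le> c\<^sup>2 / 8"
      using that by (simp add: power_mono)
    finally have "ln ((1 + exp ?h) / 2) \<le> ?h / 2 + c\<^sup>2 / 8" by argo
    then have "exp (ln ((1 + exp ?h) / 2)) \<le> exp (?h / 2 + c\<^sup>2 / 8)" by simp
    moreover have "(1 + exp ?h) / 2 > 0" by (simp add: add_pos_pos)
    ultimately have "(1 + exp ?h) / 2 \<le> exp (?h / 2 + c\<^sup>2 / 8)"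
      by (simp only: exp_ln)
    then have "exp u * (1 + exp ?h) / 2 \<le> exp u * exp (?h / 2 + c\<^sup>2 / 8)"
      unfolding times_divide_eq_right[symmetric] by (rule mult_left_mono) simp
    moreover have "exp u * (1 + exp ?h) = exp u + exp v"
      unfolding distrib_left exp_add[symmetric] by simp
    moreover have "exp u * exp (?h / 2 + c\<^sup>2 / 8) = exp ((u + v) / 2) * exp (c\<^sup>2 / 8)"
      unfolding exp_add[symmetric] by (rule arg_cong[where f = exp]) argo
    ultimately show ?thesis by simp
  qed
  show ?thesis
    using main[of u v] main[of v u] assms by (cases "u \<le> v") (simp_all add: add.commute)
qed

text \<open>Coordinates are averaged out one at a time. Replacing \<open>f\<close> by
  \<open>g\<close>, its average over the two choices for \<open>z\<close>, keeps the mean and the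
  bound \<open>c\<close> on differences, and costs a factor exp((l c)^2 / 8) by the two-point
  estimate.\<close>

lemma sum_exp_bounded_differences_le:
  fixes f :: "'a set \<Rightarrow> real"
  assumes "finite V" "\<And>S z. S \<subseteq> V \<Longrightarrow> z \<in> V \<Longrightarrow> \<bar>f (insert z S) - f S\<bar> \<le> c"
  shows "(\<Sum>S\<in>Pow V. exp (l * f S))
    \<le> 2 ^ card V * exp (l * ((\<Sum>S\<in>Pow V. f S) / 2 ^ card V) + (l * c)\<^sup>2 * card V / 8)"
  using assms
proof (induction V arbitrary: f rule: finite_induct)
  case empty
  then show ?case by simp
next
  case (insert z F)
  define g where "g S = (f S + f (insert z S)) / 2" for S
  have bd: "\<bar>g (insert y S) - g S\<bar> \<le> c" if "S \<subseteq> F" "y \<in> F" for S y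
  proof -
    have "\<bar>f (insert y S) - f S\<bar> \<le> c" "\<bar>f (insert y (insert z S)) - f (insert z S)\<bar> \<le> c"
      using that by (auto intro!: insert.prems)
    then show ?thesis unfolding g_def insert_commute[of z y] by (simp add: abs_le_iff field_simps)
  qed
  have step: "exp (l * f S) + exp (l * f (insert z S)) \<le> 2 * exp ((l * c)\<^sup>2 / 8) * exp (l * g S)"
    if "S \<subseteq> F" for S
  proof -
    have "\<bar>f (insert z S) - f S\<bar> \<le> c" using that insert.prems[of S z] by auto
    then have "\<bar>l * f S - l * f (insert z S)\<bar> \<le> \<bar>l\<bar> * c"
      by (simp add: abs_mult abs_minus_commute mult_left_mono flip: right_diff_distrib)
    from exp_add_exp_le[OF this] show ?thesis
      by (simp add: g_def distrib_left power_mult_distrib mult_ac)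
  qed
  have avg: "(\<Sum>S\<in>Pow (insert z F). f S) / 2 ^ card (insert z F) = (\<Sum>S\<in>Pow F. g S) / 2 ^ card F"
    using insert.hyps by (simp add: sum_Pow_insert g_def flip: sum_divide_distrib)
  have "(\<Sum>S\<in>Pow (insert z F). exp (l * f S)) = (\<Sum>S\<in>Pow F. exp (l * f S) + exp (l * f (insert z S)))"
    by (rule sum_Pow_insert) (use insert.hyps in auto)
  also have "\<dots> \<le> (\<Sum>S\<in>Pow F. 2 * exp ((l * c)\<^sup>2 / 8) * exp (l * g S))"
    by (intro sum_mono step) auto
  also have "\<dots> = 2 * exp ((l * c)\<^sup>2 / 8) * (\<Sum>S\<in>Pow F. exp (l * g S))"
    by (simp add: sum_distrib_left)
  also have "\<dots> \<le> 2 * exp ((l * c)\<^sup>2 / 8) *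
      (2 ^ card F * exp (l * ((\<Sum>S\<in>Pow F. g S) / 2 ^ card F) + (l * c)\<^sup>2 * card F / 8))"
    using insert.IH[of g, OF bd] by (intro mult_left_mono) auto
  also have "\<dots> = 2 ^ card (insert z F) * exp (l * ((\<Sum>S\<in>Pow F. g S) / 2 ^ card F)
      + (l * c)\<^sup>2 * card (insert z F) / 8)"
    using insert.hyps by (simp add: exp_add algebra_simps add_divide_distrib)
  finally show ?case unfolding avg .
qed

section \<open>Probabilities and tail bounds for a random subset\<close>

lemma prob_random_subset:
  assumes "finite V"
  shows "measure_pmf.prob (pmf_of_set (Pow V)) X = card {S \<in> Pow V. S \<in> X} / 2 ^ card V"
  using assms by (subst measure_pmf_of_set) (auto simp: card_Pow Int_def)

lemma prob_superset:
  assumes "finite V" "Z \<subseteq> V"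
  shows "measure_pmf.prob (pmf_of_set (Pow V)) {S. Z \<subseteq> S} = (1 / 2) ^ card Z"
proof -
  have "bij_betw (\<lambda>S. S \<union> Z) (Pow (V - Z)) {S \<in> Pow V. Z \<subseteq> S}"
    using assms(2) by (intro bij_betwI[where g = "\<lambda>S. S - Z"]) auto
  then have "card {S \<in> Pow V. Z \<subseteq> S} = 2 ^ card (V - Z)"
    using assms by (simp add: card_Pow flip: bij_betw_same_card)
  moreover have "card V = card (V - Z) + card Z"
    using assms by (simp add: card_Diff_subset finite_subset card_mono)
  ultimately show ?thesis
    using assms(1) by (simp add: prob_random_subset power_add power_divide)
qed

lemma prob_ge_mean_le:
  fixes f :: "'a set \<Rightarrow> real"
  assumes "finite V" "V \<noteq> {}" "c > 0" "t \<ge> 0"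
    and "\<And>S z. S \<subseteq> V \<Longrightarrow> z \<in> V \<Longrightarrow> \<bar>f (insert z S) - f S\<bar> \<le> c"
    and mean: "(\<Sum>S\<in>Pow V. f S) / 2 ^ card V = \<mu>"
  shows "measure_pmf.prob (pmf_of_set (Pow V)) {S. f S \<ge> \<mu> + t} \<le> exp (- 2 * t\<^sup>2 / (c\<^sup>2 * card V))"
proof -
  have n: "card V > 0" using assms by (simp add: card_gt_0_iff)
  \<comment> \<open>This value minimises the exponent (l c)^2 |V| / 8 - l t of the Chernoff
    bound.\<close>
  define l where "l = 4 * t / (c\<^sup>2 * card V)"
  have l: "l \<ge> 0" unfolding l_def using assms by simp
  let ?X = "{S \<in> Pow V. f S \<ge> \<mu> + t}"
  have "card ?X * exp (l * (\<mu> + t)) = (\<Sum>S\<in>?X. exp (l * (\<mu> + t)))" by simp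
  also have "\<dots> \<le> (\<Sum>S\<in>?X. exp (l * f S))"
    using l by (intro sum_mono) (auto intro: mult_left_mono)
  also have "\<dots> \<le> (\<Sum>S\<in>Pow V. exp (l * f S))"
    using assms(1) by (intro sum_mono2) auto
  also have "\<dots> \<le> 2 ^ card V * exp (l * \<mu> + (l * c)\<^sup>2 * card V / 8)"
    using sum_exp_bounded_differences_le[OF assms(1,5), of l] unfolding mean by simp
  finally have "card ?X / 2 ^ card V \<le> exp (l * \<mu> + (l * c)\<^sup>2 * card V / 8) / exp (l * (\<mu> + t))"
    by (simp add: field_simps)
  also have "\<dots> = exp ((l * c)\<^sup>2 * card V / 8 - l * t)"
    by (simp add: algebra_simps flip: exp_diff)
  also have "(l * c)\<^sup>2 * card V / 8 - l * t = - 2 * t\<^sup>2 / (c\<^sup>2 * card V)"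
    using n assms(3) by (simp add: l_def power2_eq_square field_simps)
  finally show ?thesis using assms(1) by (simp add: prob_random_subset)
qed

lemma prob_dist_mean_le:
  fixes f :: "'a set \<Rightarrow> real"
  assumes "finite V" "V \<noteq> {}" "c > 0" "t \<ge> 0"
    and "\<And>S z. S \<subseteq> V \<Longrightarrow> z \<in> V \<Longrightarrow> \<bar>f (insert z S) - f S\<bar> \<le> c"
    and "(\<Sum>S\<in>Pow V. f S) / 2 ^ card V = \<mu>"
  shows "measure_pmf.prob (pmf_of_set (Pow V)) {S. \<bar>f S - \<mu>\<bar> \<ge> t}
    \<le> 2 * exp (- 2 * t\<^sup>2 / (c\<^sup>2 * card V))"
proof -
  let ?P = "measure_pmf.prob (pmf_of_set (Pow V))"
  have "{S. \<bar>f S - \<mu>\<bar> \<ge> t} = {S. f S \<ge> \<mu> + t} \<union> {S. - f S \<ge> - \<mu> + t}"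
    using assms(4) by auto
  then have "?P {S. \<bar>f S - \<mu>\<bar> \<ge> t} \<le> ?P {S. f S \<ge> \<mu> + t} + ?P {S. - f S \<ge> - \<mu> + t}"
    by (simp add: measure_Un_le)
  moreover have "?P {S. f S \<ge> \<mu> + t} \<le> exp (- 2 * t\<^sup>2 / (c\<^sup>2 * card V))"
    using assms by (rule prob_ge_mean_le)
  moreover have "?P {S. - f S \<ge> - \<mu> + t} \<le> exp (- 2 * t\<^sup>2 / (c\<^sup>2 * card V))"
    using assms by (intro prob_ge_mean_le) (auto simp: sum_negf abs_minus_commute)
  ultimately show ?thesis by simp
qed

lemma prob_Bex_le:
  fixes f :: "'i \<Rightarrow> real"
  assumes "finite I" "\<And>i. i \<in> I \<Longrightarrow> measure_pmf.prob M {S. Q i S} \<le> f i"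
  shows "measure_pmf.prob M {S. \<exists>i\<in>I. Q i S} \<le> (\<Sum>i\<in>I. f i)"
proof -
  have "measure_pmf.prob M {S. \<exists>i\<in>I. Q i S} = measure_pmf.prob M (\<Union>i\<in>I. {S. Q i S})"
    by (rule arg_cong[where f = "measure_pmf.prob M"]) auto
  also have "\<dots> \<le> (\<Sum>i\<in>I. measure_pmf.prob M {S. Q i S})"
    using assms(1) by (intro measure_pmf.finite_measure_subadditive_finite) auto
  also have "\<dots> \<le> (\<Sum>i\<in>I. f i)" by (intro sum_mono assms(2))
  finally show ?thesis .
qed

section \<open>Sumsets contained in a random set\<close>

locale finite_comm_group = comm_group G for G (structure) +
  assumes finite_carrier [simp, intro]: "finite (carrier G)"
begin

lemma card_carrier_pos: "card (carrier G) > 0"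
  using finite_carrier one_closed by (auto simp: card_gt_0_iff)

lemma finite_subset_carrier: "A \<subseteq> carrier G \<Longrightarrow> finite A"
  using finite_carrier by (rule finite_subset[rotated])

lemma sumset_subset_carrier: "A \<subseteq> carrier G \<Longrightarrow> sumset G A \<subseteq> carrier G"
  unfolding sumset_def by auto

lemma finite_sumset: "A \<subseteq> carrier G \<Longrightarrow> finite (sumset G A)"
  by (intro finite_subset_carrier sumset_subset_carrier)

lemma sumset_mono: "A \<subseteq> B \<Longrightarrow> sumset G A \<subseteq> sumset G B"
  unfolding sumset_def by blast

lemma sumset_insert:
  assumes "A \<subseteq> carrier G" "y \<in> carrier G" "y \<notin> A"
  shows "sumset G (insert y A) = sumset G A \<union> (\<lambda>a. y \<otimes> a) ` A"
proof -
  have "a \<otimes> y = y \<otimes> a" if "a \<in> A" for a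
    using assms that by (intro m_comm) auto
  then show ?thesis using assms(3) unfolding sumset_def by (auto; metis)
qed

lemma card_sumset_le:
  assumes "A \<subseteq> carrier G"
  shows "card (sumset G A) \<le> (card A)\<^sup>2"
proof -
  have "card (sumset G A) \<le> card ((\<lambda>(a, b). a \<otimes> b) ` (A \<times> A))"
    using finite_subset_carrier[OF assms] unfolding sumset_def by (intro card_mono) auto
  also have "\<dots> \<le> card (A \<times> A)"
    using finite_subset_carrier[OF assms] by (intro card_image_le) auto
  finally show ?thesis by (simp add: card_cartesian_product power2_eq_square)
qed

text \<open>By cancellation \<open>y\<close> produces different sums with different elements of
  \<open>A\<close>, so the new sums can be counted by those elements. Both greedy arguments below
  measure their progress in this way.\<close>

lemma card_sumset_insert:
  assumes "A \<subseteq> carrier G" "y \<in> carrier G" "y \<notin> A"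
  shows "card (sumset G (insert y A)) = card (sumset G A) + card {a \<in> A. y \<otimes> a \<notin> sumset G A}"
proof -
  have inj: "inj_on (\<lambda>a. y \<otimes> a) A"
    using assms by (intro inj_onI) (metis Units_eq Units_l_cancel subsetD)
  have "sumset G (insert y A) = sumset G A \<union> (\<lambda>a. y \<otimes> a) ` {a \<in> A. y \<otimes> a \<notin> sumset G A}"
    unfolding sumset_insert[OF assms] by auto
  also have "card \<dots> = card (sumset G A) + card ((\<lambda>a. y \<otimes> a) ` {a \<in> A. y \<otimes> a \<notin> sumset G A})"
    using finite_sumset finite_subset_carrier assms(1) by (intro card_Un_disjoint) auto
  also have "card ((\<lambda>a. y \<otimes> a) ` {a \<in> A. y \<otimes> a \<notin> sumset G A}) = card {a \<in> A. y \<otimes> a \<notin> sumset G A}"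
    by (intro card_image inj_on_subset[OF inj]) auto
  finally show ?thesis .
qed

text \<open>Double counting of the pairs (a, b) with a b in \<open>D\<close>: once \<open>b\<close>
  and the value in \<open>D\<close> are fixed, \<open>a\<close> is determined.\<close>

lemma sum_card_translates_le:
  assumes "B \<subseteq> carrier G" "X \<subseteq> carrier G" "finite D"
  shows "(\<Sum>a\<in>X. card {b \<in> B. a \<otimes> b \<in> D}) \<le> card B * card D"
proof -
  have fin: "finite B" "finite X" using assms finite_subset_carrier by auto
  have "(\<Sum>a\<in>X. card {b \<in> B. a \<otimes> b \<in> D}) = (\<Sum>b\<in>B. card {a \<in> X. a \<otimes> b \<in> D})"
    using sum.swap_restrict[OF fin(2,1), of "\<lambda>_ _. 1::nat" "\<lambda>a b. a \<otimes> b \<in> D"] by simp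
  also have "\<dots> \<le> (\<Sum>b\<in>B. card D)"
  proof (intro sum_mono)
    fix b assume b: "b \<in> B"
    show "card {a \<in> X. a \<otimes> b \<in> D} \<le> card D"
    proof (rule card_inj_on_le)
      show "inj_on (\<lambda>a. a \<otimes> b) {a \<in> X. a \<otimes> b \<in> D}"
        using assms b by (intro inj_onI) (metis (no_types, lifting) mem_Collect_eq right_cancel subsetD)
    qed (use assms in auto)
  qed
  finally show ?thesis by simp
qed

text \<open>Greedy choice. If every remaining \<open>y\<close> had more than half of its translate
  of \<open>A'\<close> inside the sumset, the double count would allow at most 2 t^2 remaining
  elements. Hence some \<open>y\<close> adds at least t / 2 new sums, and these gains add up to t (t
  - 1) / 4.\<close>

lemma exists_subset_large_sumset:
  assumes "A \<subseteq> carrier G" "3 * t\<^sup>2 \<le> card A"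
  shows "\<exists>A'\<subseteq>A. card A' = t \<and> t * (t - 1) \<le> 4 * card (sumset G A')"
  using assms(2)
proof (induction t)
  case 0
  then show ?case by (intro exI[of _ "{}"]) auto
next
  case (Suc t)
  have "3 * t\<^sup>2 \<le> 3 * (Suc t)\<^sup>2" by (simp add: power2_eq_square)
  then obtain A' where A': "A' \<subseteq> A" "card A' = t" "t * (t - 1) \<le> 4 * card (sumset G A')"
    using Suc by (meson le_trans)
  have A'c: "A' \<subseteq> carrier G" using A' assms by auto
  let ?D = "sumset G A'"
  let ?X = "A - A'"
  have finA: "finite A" "finite A'" using assms(1) A'c finite_subset_carrier by auto
  have cX: "card ?X = card A - t" using A' finA by (simp add: card_Diff_subset)
  \<comment> \<open>At least 3 (t + 1)^2 elements are available and only \<open>t\<close> are used,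
    which leaves more than 2 t^2.\<close>
  have X: "card ?X > 2 * t\<^sup>2"
    unfolding cX using Suc.prems by (simp add: power2_eq_square)
  have "\<exists>y\<in>?X. t \<le> 2 * card {a \<in> A'. y \<otimes> a \<notin> ?D}"
  proof (rule ccontr)
    assume neg: "\<not> ?thesis"
    have "t \<le> 2 * card {a \<in> A'. y \<otimes> a \<in> ?D}" if "y \<in> ?X" for y
    proof -
      have "t = card ({a \<in> A'. y \<otimes> a \<in> ?D} \<union> {a \<in> A'. y \<otimes> a \<notin> ?D})"
        unfolding A'(2)[symmetric] by (rule arg_cong[where f = card]) auto
      also have "\<dots> = card {a \<in> A'. y \<otimes> a \<in> ?D} + card {a \<in> A'. y \<otimes> a \<notin> ?D}"
        using finA by (intro card_Un_disjoint) auto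
      finally show ?thesis using neg that by force
    qed
    then have "(\<Sum>y\<in>?X. t) \<le> (\<Sum>y\<in>?X. 2 * card {a \<in> A'. y \<otimes> a \<in> ?D})"
      by (rule sum_mono)
    also have "\<dots> = 2 * (\<Sum>y\<in>?X. card {a \<in> A'. y \<otimes> a \<in> ?D})"
      by (simp add: sum_distrib_left)
    also have "\<dots> \<le> 2 * (t * card ?D)"
      unfolding A'(2)[symmetric]
      using assms A'c by (intro mult_left_mono sum_card_translates_le finite_sumset) auto
    also have "\<dots> \<le> 2 * (t * t\<^sup>2)"
      using card_sumset_le[OF A'c] A'(2) by (intro mult_left_mono) auto
    finally have "t * card ?X \<le> t * (2 * t\<^sup>2)" by (simp add: mult_ac)
    \<comment> \<open>Cancelling a nonzero \<open>t\<close> would contradict \<open>X\<close>. For t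
      = 0 any element of the nonempty \<open>?X\<close> adds at least t / 2 sums, against
      \<open>neg\<close>.\<close>
    then have "t = 0" using X by auto
    moreover have "?X \<noteq> {}" using X by (metis card.empty not_less_zero)
    ultimately show False using neg by auto
  qed
  then obtain y where y: "y \<in> A" "y \<notin> A'" "t \<le> 2 * card {a \<in> A'. y \<otimes> a \<notin> ?D}" by auto
  have "card (sumset G (insert y A')) = card ?D + card {a \<in> A'. y \<otimes> a \<notin> ?D}"
    using y A'c assms(1) by (intro card_sumset_insert) auto
  then have "t * (t - 1) + 2 * t \<le> 4 * card (sumset G (insert y A'))"
    using A'(3) y(3) by simp
  moreover have "Suc t * (Suc t - 1) = t * (t - 1) + 2 * t" by (cases t) auto
  ultimately show ?case
    using y A' finA by (intro exI[of _ "insert y A'"]) auto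
qed

section \<open>Small cores of sets with few sums\<close>

definition mostly_covered :: "'a set \<Rightarrow> 'a set" where
  "mostly_covered B = {a \<in> carrier G. card B \<le> 2 * card {b \<in> B. a \<otimes> b \<in> sumset G B}}"

text \<open>Each such element accounts for at least |B| / 2 of the at most |B| |B + B| <= |B|^3
  pairs with a b in the sumset. The bound does not involve the order of the group, which makes
  choices inside this set cheap in a union bound.\<close>

lemma card_mostly_covered_le:
  assumes "B \<subseteq> carrier G" "B \<noteq> {}"
  shows "card (mostly_covered B) \<le> 2 * (card B)\<^sup>2"
proof -
  have B: "card B > 0" using assms finite_subset_carrier by (simp add: card_gt_0_iff)
  have "(\<Sum>a\<in>mostly_covered B. card B) \<le> (\<Sum>a\<in>mostly_covered B. 2 * card {b \<in> B. a \<otimes> b \<in> sumset G B})"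
    by (intro sum_mono) (auto simp: mostly_covered_def)
  also have "\<dots> = 2 * (\<Sum>a\<in>mostly_covered B. card {b \<in> B. a \<otimes> b \<in> sumset G B})"
    by (simp add: sum_distrib_left)
  also have "\<dots> \<le> 2 * (card B * card (sumset G B))"
    using assms by (intro mult_left_mono sum_card_translates_le finite_sumset)
      (auto simp: mostly_covered_def)
  also have "\<dots> \<le> 2 * (card B * (card B)\<^sup>2)"
    using card_sumset_le[OF assms(1)] by (intro mult_left_mono) auto
  finally have "card B * card (mostly_covered B) \<le> card B * (2 * (card B)\<^sup>2)" by (simp add: mult_ac)
  then show ?thesis using B by simp
qed

text \<open>Maximising \<open>|B + B| - 10 x |B|\<close> over large subsets \<open>B\<close> of \<open>A\<close> makes every other element of
  \<open>A\<close> contribute at most \<open>10 x\<close> new sums.\<close>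

lemma exists_core:
  fixes x :: real
  assumes "A \<subseteq> carrier G" "x > 0" "card A \<ge> b\<^sub>0" "20 * x \<le> b\<^sub>0"
    and sparse: "\<And>B. B \<subseteq> A \<Longrightarrow> B \<noteq> {} \<Longrightarrow> card (sumset G B) < 5 * x * card B"
  obtains B where "B \<subseteq> A" "B \<noteq> {}" "card B \<le> 2 * b\<^sub>0" "A \<subseteq> B \<union> mostly_covered B"
proof -
  define \<phi> where "\<phi> B = card (sumset G B) - 10 * x * card B" for B
  let ?F = "{B. B \<subseteq> A \<and> b\<^sub>0 \<le> card B}"
  have finA: "finite A" using assms finite_subset_carrier by auto
  obtain B\<^sub>0 where B0: "B\<^sub>0 \<subseteq> A" "card B\<^sub>0 = b\<^sub>0" using assms(3) by (meson obtain_subset_with_card_n)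
  have "finite ?F" "?F \<noteq> {}" using finA B0 by auto
  then have "Max (\<phi> ` ?F) \<in> \<phi> ` ?F" "\<forall>B\<in>?F. \<phi> B \<le> Max (\<phi> ` ?F)"
    by (intro Max_in ballI Max_ge; blast)+
  then obtain B where B: "B \<subseteq> A" "b\<^sub>0 \<le> card B" and mx: "\<And>B'. B' \<in> ?F \<Longrightarrow> \<phi> B' \<le> \<phi> B"
    by (auto simp del: Max_in)
  have Bc: "B \<subseteq> carrier G" and finB: "finite B" using B assms finite_subset_carrier by auto
  have Bne: "B \<noteq> {}" using B assms(2,4) by auto
  \<comment> \<open>The penalty 10 x is twice the density allowed by \<open>sparse\<close>.
    Comparing the maximiser with a subset of size exactly \<open>b\<^sub>0\<close> therefore shows
    that it is at most twice as large.\<close>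
  have "- 10 * x * b\<^sub>0 \<le> \<phi> B\<^sub>0" unfolding \<phi>_def B0 by simp
  also have "\<dots> \<le> \<phi> B" using B0 by (intro mx) auto
  also have "\<dots> \<le> - 5 * x * card B" using sparse[OF B(1) Bne] unfolding \<phi>_def by simp
  finally have "5 * x * card B \<le> 5 * x * (2 * b\<^sub>0)" by simp
  then have "real (card B) \<le> 2 * b\<^sub>0" using assms(2) by (subst (asm) mult_le_cancel_left_pos) auto
  then have "card B \<le> 2 * b\<^sub>0" by linarith
  moreover have "A \<subseteq> B \<union> mostly_covered B"
  proof
    fix a assume a: "a \<in> A"
    show "a \<in> B \<union> mostly_covered B"
    proof (cases "a \<in> B")
      case False
      have ac: "a \<in> carrier G" using a assms by auto
      \<comment> \<open>By maximality \<open>a\<close> brings at most 10 x new sums. As |B| >= 20 x,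
        this is at most half of its translate of \<open>B\<close>.\<close>
      have "\<phi> (insert a B) \<le> \<phi> B" using a B finB False by (intro mx) auto
      then have new: "card {b \<in> B. a \<otimes> b \<notin> sumset G B} \<le> 10 * x"
        using False finB unfolding \<phi>_def card_sumset_insert[OF Bc ac False] by (simp add: algebra_simps)
      have "card B = card ({b \<in> B. a \<otimes> b \<in> sumset G B} \<union> {b \<in> B. a \<otimes> b \<notin> sumset G B})"
        by (rule arg_cong[where f = card]) auto
      also have "\<dots> = card {b \<in> B. a \<otimes> b \<in> sumset G B} + card {b \<in> B. a \<otimes> b \<notin> sumset G B}"
        using finB by (intro card_Un_disjoint) auto
      finally have "card B \<le> 2 * card {b \<in> B. a \<otimes> b \<in> sumset G B}"
        using new assms(4) B(2) by linarith
      then show ?thesis using ac by (simp add: mostly_covered_def)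
    qed simp
  qed
  ultimately show thesis using that B(1) Bne by blast
qed

section \<open>Union bounds for sumsets inside a random set\<close>

lemma prob_sumset_subset:
  assumes "A \<subseteq> carrier G"
  shows "measure_pmf.prob (pmf_of_set (Pow (carrier G))) {S. sumset G A \<subseteq> S}
    = (1 / 2) ^ card (sumset G A)"
  using assms by (intro prob_superset sumset_subset_carrier) auto

text \<open>Union bound over pairs (B, A): only the core \<open>B\<close> is chosen from the whole
  group, while \<open>A\<close> is chosen from O(b^2) elements determined by \<open>B\<close>. Each
  pair succeeds with probability at most 2^(-s).\<close>

lemma prob_large_sumset_of_cored_set_le:
  assumes "b \<ge> 1"
  shows "measure_pmf.prob (pmf_of_set (Pow (carrier G)))
     {S. \<exists>B A. B \<subseteq> carrier G \<and> B \<noteq> {} \<and> card B \<le> b \<and> A \<subseteq> B \<union> mostly_covered B \<and> card A \<le> n \<and>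
          s \<le> card (sumset G A) \<and> sumset G A \<subseteq> S}
    \<le> (card (carrier G) + 1) ^ b * (4 * b\<^sup>2) ^ n * (1 / 2) ^ s"
proof -
  let ?P = "measure_pmf.prob (pmf_of_set (Pow (carrier G)))"
  let ?I = "{B. B \<subseteq> carrier G \<and> B \<noteq> {} \<and> card B \<le> b}"
  let ?J = "\<lambda>B. {A. A \<subseteq> B \<union> mostly_covered B \<and> card A \<le> n}"
  let ?K = "Sigma ?I (\<lambda>B. {A \<in> ?J B. s \<le> card (sumset G A)})"
  have mc: "B \<union> mostly_covered B \<subseteq> carrier G" if "B \<in> ?I" for B
    using that by (auto simp: mostly_covered_def)
  have finJ: "finite (?J B)" if "B \<in> ?I" for B
    using mc[OF that] by (auto intro: finite_subset[of _ "Pow (carrier G)"])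
  have finI: "finite ?I" by (auto intro: finite_subset[of _ "Pow (carrier G)"])
  have finJs: "finite {A \<in> ?J B. s \<le> card (sumset G A)}" if "B \<in> ?I" for B
    using finJ[OF that] by (rule finite_subset[rotated]) auto
  have finK: "finite ?K" using finI finJs by (intro finite_SigmaI)
  have cJ: "card (?J B) \<le> (4 * b\<^sup>2) ^ n" if "B \<in> ?I" for B
  proof -
    have fB: "finite (B \<union> mostly_covered B)" using mc[OF that] by (rule finite_subset_carrier)
    have "card (B \<union> mostly_covered B) \<le> card B + card (mostly_covered B)" by (rule card_Un_le)
    also have "\<dots> \<le> b + 2 * b\<^sup>2"
    proof (rule add_mono)
      have "card (mostly_covered B) \<le> 2 * (card B)\<^sup>2"
        using that by (intro card_mostly_covered_le) auto
      also have "\<dots> \<le> 2 * b\<^sup>2" using that by (simp add: power_mono)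
      finally show "card (mostly_covered B) \<le> 2 * b\<^sup>2" .
    qed (use that in simp)
    \<comment> \<open>The sum b + 2 b^2 + 1 is at most 4 b^2 because b >= 1; the extra 1 is the one
      in \<open>card_subsets_card_le\<close>.\<close>
    finally have "card (B \<union> mostly_covered B) + 1 \<le> 4 * b\<^sup>2"
      using assms self_le_power[of b 2] by simp
    with card_subsets_card_le[OF fB, of n] show ?thesis
      by (meson le_trans power_mono le0)
  qed
  have "card ?I \<le> card {B. B \<subseteq> carrier G \<and> card B \<le> b}"
    by (intro card_mono) (auto intro: finite_subset[of _ "Pow (carrier G)"])
  also have "\<dots> \<le> (card (carrier G) + 1) ^ b" by (rule card_subsets_card_le) simp
  finally have cI: "card ?I \<le> (card (carrier G) + 1) ^ b" .
  have "card ?K = (\<Sum>B\<in>?I. card {A \<in> ?J B. s \<le> card (sumset G A)})"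
    using finI finJs by (intro card_SigmaI) auto
  also have "\<dots> \<le> (\<Sum>B\<in>?I. (4 * b\<^sup>2) ^ n)"
  proof (intro sum_mono)
    fix B assume B: "B \<in> ?I"
    have "card {A \<in> ?J B. s \<le> card (sumset G A)} \<le> card (?J B)"
      using finJ[OF B] by (intro card_mono) auto
    then show "card {A \<in> ?J B. s \<le> card (sumset G A)} \<le> (4 * b\<^sup>2) ^ n"
      using cJ[OF B] by linarith
  qed
  also have "\<dots> = card ?I * (4 * b\<^sup>2) ^ n" by simp
  also have "\<dots> \<le> (card (carrier G) + 1) ^ b * (4 * b\<^sup>2) ^ n"
    using cI by (intro mult_right_mono) auto
  finally have cK: "card ?K \<le> (card (carrier G) + 1) ^ b * (4 * b\<^sup>2) ^ n" .
  have "?P {S. \<exists>p\<in>?K. sumset G (snd p) \<subseteq> S} \<le> (\<Sum>p\<in>?K. (1 / 2) ^ s)"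
  proof (rule prob_Bex_le[OF finK])
    fix p assume p: "p \<in> ?K"
    then obtain B A where BA: "p = (B, A)" "B \<in> ?I" "A \<in> ?J B" "s \<le> card (sumset G A)" by auto
    then have "A \<subseteq> carrier G" using mc[OF BA(2)] by auto
    then have "?P {S. sumset G A \<subseteq> S} = (1 / 2) ^ card (sumset G A)" by (rule prob_sumset_subset)
    also have "\<dots> \<le> (1 / 2) ^ s" using BA(4) by (intro power_decreasing) auto
    finally show "?P {S. sumset G (snd p) \<subseteq> S} \<le> (1 / 2) ^ s" using BA(1) by simp
  qed
  also have "\<dots> = card ?K * (1 / 2) ^ s" by simp
  also have "\<dots> \<le> real ((card (carrier G) + 1) ^ b * (4 * b\<^sup>2) ^ n) * (1 / 2) ^ s"
    using cK by (intro mult_right_mono) (simp_all only: of_nat_le_iff, simp)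
  finally have "?P {S. \<exists>p\<in>?K. sumset G (snd p) \<subseteq> S}
    \<le> (card (carrier G) + 1) ^ b * (4 * b\<^sup>2) ^ n * (1 / 2) ^ s" by simp
  moreover have "{S. \<exists>p\<in>?K. sumset G (snd p) \<subseteq> S} = {S. \<exists>B A. B \<subseteq> carrier G \<and> B \<noteq> {} \<and> card B \<le> b \<and>
      A \<subseteq> B \<union> mostly_covered B \<and> card A \<le> n \<and> s \<le> card (sumset G A) \<and> sumset G A \<subseteq> S}"
    (is "?X = ?Y")
  proof (intro equalityI subsetI)
    fix S assume "S \<in> ?Y"
    then obtain B A where "(B, A) \<in> ?K" "sumset G A \<subseteq> S" by blast
    then show "S \<in> ?X" by force
  qed force
  ultimately show ?thesis by simp
qed

text \<open>There are at most N^b sets of size b, and each fits with probability at most N^(-3 b).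
  Every size thus contributes at most N^(-2), and there are N sizes.\<close>

lemma prob_dense_sumset_le:
  assumes "card (carrier G) \<ge> 2"
  shows "measure_pmf.prob (pmf_of_set (Pow (carrier G)))
     {S. \<exists>B. B \<subseteq> carrier G \<and> B \<noteq> {} \<and> 5 * ln (card (carrier G)) * card B \<le> card (sumset G B) \<and> sumset G B \<subseteq> S}
    \<le> 1 / card (carrier G)"
proof -
  let ?P = "measure_pmf.prob (pmf_of_set (Pow (carrier G)))"
  let ?N = "card (carrier G)"
  let ?I = "\<lambda>b. {B. B \<subseteq> carrier G \<and> card B = b \<and> 5 * ln ?N * b \<le> card (sumset G B)}"
  have finI: "finite (?I b)" for b by (auto intro: finite_subset[of _ "Pow (carrier G)"])
  have N: "real ?N > 1" using assms by simp
  have half: "(1 / 2 :: real) ^ s \<le> (1 / ?N ^ 3) ^ b" if "5 * ln ?N * b \<le> s" for s b :: nat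
  proof -
    have cube: "exp (3 * ln ?N) = ?N ^ 3"
      using N exp_of_nat_mult[of 3 "ln ?N"] by simp
    \<comment> \<open>The constant 5 is chosen so that 5 ln 2 >= 3, which turns 2^(-5 b ln N) into
      at most N^(-3 b).\<close>
    have "3 / 5 \<le> ln (2 :: real)" using ln2_ge_two_thirds by simp
    then have "5 * ln ?N * b * (3 / 5) \<le> 5 * ln ?N * b * ln 2"
      using N by (intro mult_left_mono) auto
    also have "\<dots> \<le> s * ln 2" using that by (intro mult_right_mono) auto
    finally have "exp (- (s * ln 2)) \<le> exp (- (b * (3 * ln ?N)))" by (simp add: mult_ac)
    also have "exp (- (s * ln 2)) = (1 / 2 :: real) ^ s"
      by (simp add: exp_minus exp_of_nat_mult power_divide inverse_eq_divide)
    also have "exp (- (b * (3 * ln ?N))) = (1 / ?N ^ 3) ^ b"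
      unfolding exp_minus exp_of_nat_mult cube by (simp add: power_divide inverse_eq_divide)
    finally show ?thesis .
  qed
  have fixed_card: "?P {S. \<exists>B\<in>?I b. sumset G B \<subseteq> S} \<le> 1 / ?N ^ 2" if "b \<ge> 1" "b \<le> ?N" for b
  proof -
    have "?P {S. \<exists>B\<in>?I b. sumset G B \<subseteq> S} \<le> (\<Sum>B\<in>?I b. (1 / ?N ^ 3) ^ b)"
      by (rule prob_Bex_le[OF finI]) (use half prob_sumset_subset in auto)
    also have "\<dots> = card (?I b) * (1 / ?N ^ 3) ^ b" by simp
    also have "card (?I b) \<le> card {B. B \<subseteq> carrier G \<and> card B = b}"
      by (intro card_mono) (auto intro: finite_subset[of _ "Pow (carrier G)"])
    also have "\<dots> = ?N choose b" by (rule n_subsets) simp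
    also have "\<dots> \<le> ?N ^ b" using that by (intro binomial_le_pow) auto
    also have "real (?N ^ b) * (1 / ?N ^ 3) ^ b = (?N * (1 / ?N ^ 3)) ^ b"
      unfolding of_nat_power power_mult_distrib ..
    also have "?N * (1 / ?N ^ 3) = 1 / real ?N ^ 2"
      using N by (simp add: power2_eq_square power3_eq_cube)
    also have "(1 / real ?N ^ 2) ^ b \<le> (1 / real ?N ^ 2) ^ 1"
      using that N by (intro power_decreasing) (auto simp: divide_le_eq_1)
    finally show ?thesis by (simp add: mult_right_mono)
  qed
  have "?P {S. \<exists>b\<in>{1..?N}. \<exists>B\<in>?I b. sumset G B \<subseteq> S} \<le> (\<Sum>b\<in>{1..?N}. 1 / ?N ^ 2)"
    by (rule prob_Bex_le) (use fixed_card in auto)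
  also have "\<dots> = 1 / ?N" by (simp add: power2_eq_square)
  also have "{S. \<exists>b\<in>{1..?N}. \<exists>B\<in>?I b. sumset G B \<subseteq> S} =
    {S. \<exists>B. B \<subseteq> carrier G \<and> B \<noteq> {} \<and> 5 * ln ?N * card B \<le> card (sumset G B) \<and> sumset G B \<subseteq> S}"
  proof (intro Collect_cong iffI; elim exE bexE conjE)
    fix S B assume "B \<subseteq> carrier G" "B \<noteq> {}" "5 * ln ?N * card B \<le> card (sumset G B)" "sumset G B \<subseteq> S"
    moreover from this have "card B \<in> {1..?N}"
      using finite_subset_carrier[of B] by (auto simp: card_mono Suc_le_eq card_gt_0_iff)
    ultimately show "\<exists>b\<in>{1..?N}. \<exists>B\<in>?I b. sumset G B \<subseteq> S" by blast
  qed auto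
  finally show ?thesis by simp
qed

end

section \<open>Covering by sumsets of weak Sidon sets\<close>

lemma (in group) union_of_sumsets_Un:
  assumes "union_of_sumsets G m S" "union_of_sumsets G n T"
  shows "union_of_sumsets G (m + n) (S \<union> T)"
proof -
  obtain A B where A: "\<forall>i<m. A i \<subseteq> carrier G" "S = (\<Union>i<m. sumset G (A i))"
    and B: "\<forall>i<n. B i \<subseteq> carrier G" "T = (\<Union>i<n. sumset G (B i))"
    using assms unfolding union_of_sumsets_def by blast
  let ?C = "\<lambda>i. if i < m then A i else B (i - m)"
  have "{..<m + n} = {..<m} \<union> (\<lambda>i. m + i) ` {..<n}"
    by (simp add: lessThan_atLeast0 ivl_disj_un add.commute)
  then have "(\<Union>i<m + n. sumset G (?C i)) = S \<union> T" unfolding A(2) B(2) by (simp add: UN_Un)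
  moreover have "\<forall>i<m + n. ?C i \<subseteq> carrier G" using A(1) B(1) by auto
  ultimately show ?thesis unfolding union_of_sumsets_def by (intro exI[of _ ?C]) auto
qed

lemma (in group) union_of_sumsets_sumset:
  "A \<subseteq> carrier G \<Longrightarrow> union_of_sumsets G 1 (sumset G A)"
  unfolding union_of_sumsets_def by (intro exI[of _ "\<lambda>_. A"]) auto

lemma (in group) union_of_sumsets_empty: "union_of_sumsets G 0 {}"
  unfolding union_of_sumsets_def by auto

lemma (in group) union_of_sumsets_card:
  assumes "finite R" "\<And>x. x \<in> R \<Longrightarrow> \<exists>A\<subseteq>carrier G. sumset G A = {x}"
  shows "union_of_sumsets G (card R) R"
  using assms
proof (induction R rule: finite_induct)
  case empty
  then show ?case using union_of_sumsets_empty by simp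
next
  case (insert x R)
  obtain A where "A \<subseteq> carrier G" "sumset G A = {x}" using insert.prems by blast
  then have "union_of_sumsets G (1 + card R) ({x} \<union> R)"
    using union_of_sumsets_sumset[of A] insert by (intro union_of_sumsets_Un) auto
  then show ?case using insert.hyps by simp
qed

section \<open>Weak Sidon cliques and their extensions\<close>

context finite_comm_group
begin

text \<open>Squares are left unconstrained, in line with \<open>sumset\<close>. An ordinary Sidon
  set in a group of exponent 2 would have at most one element.\<close>

definition weak_sidon :: "'a set \<Rightarrow> bool" where
  "weak_sidon A \<longleftrightarrow> (\<forall>a\<in>A. \<forall>b\<in>A. \<forall>c\<in>A. \<forall>d\<in>A.
     a \<noteq> b \<and> c \<noteq> d \<and> a \<otimes> b = c \<otimes> d \<longrightarrow> {a, b} = {c, d})"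

text \<open>These are cliques of the Cayley sum graph of \<open>S\<close>, where distinct elements
  are adjacent when their product lies in \<open>S\<close>. The set \<open>P\<close> is a prescribed
  part: empty to count all cliques, a pair to count those representing a given product in a given
  way.\<close>

definition sidon_cliques :: "'a set \<Rightarrow> nat \<Rightarrow> 'a set \<Rightarrow> 'a set set" where
  "sidon_cliques S j P =
     {A. A \<subseteq> carrier G \<and> card A = j \<and> sumset G A \<subseteq> S \<and> weak_sidon A \<and> P \<subseteq> A}"

definition extensions :: "'a set \<Rightarrow> 'a set \<Rightarrow> 'a set" where
  "extensions S A = {y \<in> carrier G - A. sumset G (insert y A) \<subseteq> S \<and> weak_sidon (insert y A)}"

text \<open>Elements of \<open>A\<close> itself are not removed, so that for a random
  \<open>S\<close> the expected size is exactly N / 2^|A|.\<close>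

definition common_nbhd :: "'a set \<Rightarrow> 'a set \<Rightarrow> 'a set" where
  "common_nbhd S A = {y \<in> carrier G. \<forall>a\<in>A. y \<otimes> a \<in> S}"

lemma weak_sidon_mono: "weak_sidon B \<Longrightarrow> A \<subseteq> B \<Longrightarrow> weak_sidon A"
  unfolding weak_sidon_def by (meson subsetD)

lemma finite_sidon_cliques: "finite (sidon_cliques S j P)"
  unfolding sidon_cliques_def by (rule finite_subset[of _ "Pow (carrier G)"]) auto

lemma finite_extensions: "finite (extensions S A)"
  unfolding extensions_def by (rule finite_subset[of _ "carrier G"]) auto

lemma finite_common_nbhd: "finite (common_nbhd S A)"
  unfolding common_nbhd_def by (rule finite_subset[of _ "carrier G"]) auto

text \<open>Double counting of pairs (A, y) with \<open>y\<close> an extension of \<open>A\<close>: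
  such a pair is the same as a clique of size j + 1 with a marked element outside
  \<open>P\<close>.\<close>

lemma sum_card_extensions:
  "(\<Sum>A\<in>sidon_cliques S j P. card (extensions S A))
    = (Suc j - card P) * card (sidon_cliques S (Suc j) P)"
proof -
  let ?F = "\<lambda>j. sidon_cliques S j P"
  have finA: "finite A" if "A \<in> ?F i" for A i
    using that finite_subset_carrier by (auto simp: sidon_cliques_def)
  have "bij_betw (\<lambda>(A, y). (insert y A, y)) (Sigma (?F j) (extensions S)) (Sigma (?F (Suc j)) (\<lambda>A. A - P))"
  proof (rule bij_betwI[where g = "\<lambda>(A, y). (A - {y}, y)"])
    show "(\<lambda>(A, y). (insert y A, y)) \<in> Sigma (?F j) (extensions S) \<rightarrow> Sigma (?F (Suc j)) (\<lambda>A. A - P)"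
    proof
      fix p assume "p \<in> Sigma (?F j) (extensions S)"
      then obtain A y where p: "p = (A, y)" "A \<in> ?F j" "y \<in> extensions S A" by auto
      with finA[of A j] show "(case p of (A, y) \<Rightarrow> (insert y A, y)) \<in> Sigma (?F (Suc j)) (\<lambda>A. A - P)"
        by (auto simp: sidon_cliques_def extensions_def)
    qed
    show "(\<lambda>(A, y). (A - {y}, y)) \<in> Sigma (?F (Suc j)) (\<lambda>A. A - P) \<rightarrow> Sigma (?F j) (extensions S)"
    proof
      fix p assume "p \<in> Sigma (?F (Suc j)) (\<lambda>A. A - P)"
      then obtain A y where p: "p = (A, y)" "A \<in> ?F (Suc j)" "y \<in> A - P" by auto
      moreover have "sumset G (A - {y}) \<subseteq> sumset G A" by (rule sumset_mono) auto
      moreover have "weak_sidon A \<Longrightarrow> weak_sidon (A - {y})" by (erule weak_sidon_mono) auto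
      moreover have "insert y (A - {y}) = A" using p by auto
      ultimately show "(case p of (A, y) \<Rightarrow> (A - {y}, y)) \<in> Sigma (?F j) (extensions S)"
        by (auto simp: sidon_cliques_def extensions_def)
    qed
    show "(case case p of (A, y) \<Rightarrow> (insert y A, y) of (A, y) \<Rightarrow> (A - {y}, y)) = p"
      if "p \<in> Sigma (?F j) (extensions S)" for p
      using that by (auto simp: extensions_def)
    show "(case case p of (A, y) \<Rightarrow> (A - {y}, y) of (A, y) \<Rightarrow> (insert y A, y)) = p"
      if "p \<in> Sigma (?F (Suc j)) (\<lambda>A. A - P)" for p
      using that by auto
  qed
  then have "card (Sigma (?F j) (extensions S)) = card (Sigma (?F (Suc j)) (\<lambda>A. A - P))"
    by (rule bij_betw_same_card)
  moreover have "card (Sigma (?F j) (extensions S)) = (\<Sum>A\<in>?F j. card (extensions S A))"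
    using finite_sidon_cliques finite_extensions by (intro card_SigmaI) auto
  moreover have "card (Sigma (?F (Suc j)) (\<lambda>A. A - P)) = (\<Sum>A\<in>?F (Suc j). card (A - P))"
    using finite_sidon_cliques finA by (intro card_SigmaI) auto
  moreover have "card (A - P) = Suc j - card P" if "A \<in> ?F (Suc j)" for A
    using that finA[OF that] finite_subset[of P A]
    by (subst card_Diff_subset) (auto simp: sidon_cliques_def)
  ultimately show ?thesis by simp
qed

lemma extensions_subset_common_nbhd:
  assumes "A \<subseteq> carrier G"
  shows "extensions S A \<subseteq> common_nbhd S A"
  using assms unfolding extensions_def common_nbhd_def by (auto simp: sumset_insert)

text \<open>A new coincidence must involve \<open>y\<close>. If \<open>y\<close> is on both sides it
  cancels; if it is on one side only, then y a = b c, which is excluded by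
  \<open>new\<close>.\<close>

lemma weak_sidon_insert:
  assumes "A \<subseteq> carrier G" "weak_sidon A" "y \<in> carrier G" "y \<notin> A"
    and new: "\<And>a b c. a \<in> A \<Longrightarrow> b \<in> A \<Longrightarrow> c \<in> A \<Longrightarrow> y \<noteq> b \<otimes> c \<otimes> inv a"
  shows "weak_sidon (insert y A)"
proof -
  have new': "y \<otimes> a \<noteq> b \<otimes> c" if "a \<in> A" "b \<in> A" "c \<in> A" for a b c
  proof
    assume "y \<otimes> a = b \<otimes> c"
    then have "y = b \<otimes> c \<otimes> inv a"
      using assms(1,3) that by (metis inv_solve_right m_closed subsetD)
    then show False using new that by blast
  qed
  have canc: "a = b" if "y \<otimes> a = y \<otimes> b" "a \<in> A" "b \<in> A" for a b
    using that assms(1,3) by (metis Units_eq Units_l_cancel subsetD)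
  have comm: "a \<otimes> y = y \<otimes> a" if "a \<in> A" for a
    using that assms(1,3) by (intro m_comm) auto
  have pair: "\<exists>a\<in>A. {p, q} = {y, a} \<and> p \<otimes> q = y \<otimes> a"
    if "p \<in> insert y A" "q \<in> insert y A" "p \<noteq> q" "y \<in> {p, q}" for p q
  proof (cases "p = y")
    case True
    then show ?thesis using that by (intro bexI[of _ q]) auto
  next
    case False
    then have "q = y" "p \<in> A" using that by auto
    then show ?thesis using comm[of p] by (intro bexI[of _ p]) auto
  qed
  show ?thesis
    unfolding weak_sidon_def
  proof (intro ballI impI, elim conjE)
    fix a b c d
    assume m: "a \<in> insert y A" "b \<in> insert y A" and n: "c \<in> insert y A" "d \<in> insert y A"
      and ab: "a \<noteq> b" and cd: "c \<noteq> d" and eq: "a \<otimes> b = c \<otimes> d"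
    show "{a, b} = {c, d}"
    proof (cases "y \<in> {a, b}"; cases "y \<in> {c, d}")
      assume y: "y \<in> {a, b}" "y \<in> {c, d}"
      show ?thesis using pair[OF m ab y(1)] pair[OF n cd y(2)] eq canc by metis
    next
      assume y: "y \<in> {a, b}" "y \<notin> {c, d}"
      then have "c \<in> A" "d \<in> A" using n by auto
      then show ?thesis using pair[OF m ab y(1)] eq new' by metis
    next
      assume y: "y \<notin> {a, b}" "y \<in> {c, d}"
      then have "a \<in> A" "b \<in> A" using m by auto
      then show ?thesis using pair[OF n cd y(2)] eq new' by metis
    next
      assume "y \<notin> {a, b}" "y \<notin> {c, d}"
      then have "a \<in> A" "b \<in> A" "c \<in> A" "d \<in> A" using m n by auto
      then show ?thesis using ab cd eq assms(2) unfolding weak_sidon_def by blast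
    qed
  qed
qed

text \<open>A common neighbour fails to be an extension only if it lies in \<open>A\<close> or is
  one of at most j^3 elements b c a^(-1), so the weak Sidon condition is almost free.\<close>

lemma card_common_nbhd_le:
  assumes "A \<in> sidon_cliques S j P"
  shows "card (common_nbhd S A) \<le> card (extensions S A) + j + j ^ 3"
proof -
  have A: "A \<subseteq> carrier G" "card A = j" "sumset G A \<subseteq> S" "weak_sidon A"
    using assms by (auto simp: sidon_cliques_def)
  have finA: "finite A" using A finite_subset_carrier by auto
  let ?E = "(\<lambda>(a, b, c). b \<otimes> c \<otimes> inv a) ` (A \<times> A \<times> A)"
  have "common_nbhd S A \<subseteq> extensions S A \<union> A \<union> ?E"
  proof
    fix y assume y: "y \<in> common_nbhd S A"
    show "y \<in> extensions S A \<union> A \<union> ?E"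
    proof (rule ccontr)
      assume n: "y \<notin> extensions S A \<union> A \<union> ?E"
      have yc: "y \<in> carrier G" using y by (auto simp: common_nbhd_def)
      have "weak_sidon (insert y A)"
        using n A yc by (intro weak_sidon_insert) force+
      moreover have "sumset G (insert y A) \<subseteq> S"
        using A n yc y by (subst sumset_insert) (auto simp: common_nbhd_def)
      ultimately show False using n yc by (auto simp: extensions_def)
    qed
  qed
  then have "card (common_nbhd S A) \<le> card (extensions S A \<union> A \<union> ?E)"
    using finA finite_extensions by (intro card_mono) auto
  also have "\<dots> \<le> card (extensions S A) + card A + card ?E"
    using card_Un_le[of "extensions S A \<union> A" ?E] card_Un_le[of "extensions S A" A] by linarith
  also have "card ?E \<le> card (A \<times> A \<times> A)" using finA by (intro card_image_le) auto
  also have "\<dots> = j ^ 3" using A by (simp add: card_cartesian_product power3_eq_cube)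
  finally show ?thesis using A by simp
qed

end

text \<open>The relative error 1 / (12 k) is small enough to lose only a constant factor after the
  up to k extension steps by which cliques are built. By \<open>k_small\<close> the elements lost to
  the weak Sidon condition stay within the same relative error, even for the smallest main term N /
  2^k.\<close>

locale pseudorandom_set = finite_comm_group +
  fixes S :: "'a set" and k :: nat
  assumes k_ge_2: "k \<ge> 2"
    and card_common_nbhd: "\<And>A. A \<subseteq> carrier G \<Longrightarrow> A \<noteq> {} \<Longrightarrow> card A \<le> k \<Longrightarrow>
      \<bar>card (common_nbhd S A) - card (carrier G) / 2 ^ card A\<bar> \<le> card (carrier G) / 2 ^ card A / (12 * k)"
    and k_small: "k + k ^ 3 \<le> card (carrier G) / 2 ^ k / (12 * real k)"
begin

text \<open>Extensions are common neighbours, which gives the upper bound. The lower bound pays the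
  error 1 / (12 k) twice: for the deviation and for the at most j + j^3 discarded elements.\<close>

lemma card_extensions_bounds:
  assumes "A \<in> sidon_cliques S j P" "1 \<le> j" "j \<le> k"
  shows "card (extensions S A) \<le> card (carrier G) / 2 ^ j * (1 + 1 / (12 * k))"
    and "card (extensions S A) \<ge> card (carrier G) / 2 ^ j * (1 - 2 / (12 * k))"
proof -
  let ?M = "card (carrier G) / 2 ^ j"
  have A: "A \<subseteq> carrier G" "card A = j" "A \<noteq> {}"
    using assms by (auto simp: sidon_cliques_def)
  have dev: "\<bar>card (common_nbhd S A) - ?M\<bar> \<le> ?M / (12 * k)"
    using card_common_nbhd[of A] A assms by simp
  have "card (extensions S A) \<le> card (common_nbhd S A)"
    using A finite_common_nbhd by (intro card_mono extensions_subset_common_nbhd)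
  moreover have "card (common_nbhd S A) \<le> ?M + ?M / (12 * k)"
    using dev unfolding abs_le_iff by linarith
  ultimately have "card (extensions S A) \<le> ?M + ?M / (12 * k)" by linarith
  also have "\<dots> = ?M * (1 + 1 / (12 * k))" by (simp add: distrib_left)
  finally show "card (extensions S A) \<le> ?M * (1 + 1 / (12 * k))" .
  have "j + j ^ 3 \<le> k + k ^ 3" using assms by (intro add_mono power_mono) auto
  then have "real (j + j ^ 3) \<le> card (carrier G) / 2 ^ k / (12 * k)"
    using k_small by linarith
  also have "\<dots> \<le> ?M / (12 * k)"
    using assms by (intro divide_right_mono divide_left_mono power_increasing) auto
  finally have small: "real (j + j ^ 3) \<le> ?M / (12 * k)" .
  have "real (card (common_nbhd S A)) \<le> card (extensions S A) + real (j + j ^ 3)"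
    using card_common_nbhd_le[OF assms(1)] by linarith
  moreover have "card (common_nbhd S A) \<ge> ?M - ?M / (12 * k)"
    using dev unfolding abs_le_iff by linarith
  ultimately have "?M - ?M / (12 * k) \<le> card (extensions S A) + ?M / (12 * k)"
    using small by (meson add_left_mono order_trans)
  moreover have "?M * (1 - 2 / (12 * k)) = ?M - ?M / (12 * k) - ?M / (12 * k)"
    by (simp add: right_diff_distrib)
  ultimately show "card (extensions S A) \<ge> ?M * (1 - 2 / (12 * k))" by argo
qed

text \<open>Starting from a singleton, each clique of size below \<open>k\<close> has an extension.
  Averages over cliques of size \<open>k\<close> are therefore over a nonempty family.\<close>

lemma card_sidon_cliques_pos:
  assumes "1 \<le> j" "j \<le> k"
  shows "card (sidon_cliques S j {}) > 0"
  using assms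
proof (induction j rule: dec_induct)
  case base
  have "{\<one>} \<in> sidon_cliques S 1 {}"
    by (auto simp: sidon_cliques_def sumset_def weak_sidon_def)
  then show ?case using finite_sidon_cliques by (auto simp: card_gt_0_iff)
next
  case (step j)
  then obtain A where A: "A \<in> sidon_cliques S j {}" by (auto simp: card_gt_0_iff)
  have "1 - 2 / (12 * real k) > 0" using k_ge_2 by simp
  then have "0 < card (carrier G) / 2 ^ j * (1 - 2 / (12 * k))"
    using card_carrier_pos by (intro mult_pos_pos) auto
  also have "\<dots> \<le> card (extensions S A)" using A step by (intro card_extensions_bounds(2)) auto
  finally have "0 < card (extensions S A)" by simp
  also have "\<dots> \<le> (\<Sum>A\<in>sidon_cliques S j {}. card (extensions S A))"
    using A finite_sidon_cliques by (intro member_le_sum) auto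
  finally show ?case unfolding sum_card_extensions by (auto simp: zero_less_mult_iff)
qed

text \<open>Both counts grow by nearly the same factor N / 2^j per step, up to the divisors j + 1
  (all cliques) and j - 1 (cliques containing \<open>P\<close>). These divisors turn j (j - 1) into
  (j + 1) j, and each step loses a factor 1 - 1 / (4 k).\<close>

lemma card_sidon_cliques_containing_pair:
  assumes P: "P \<in> sidon_cliques S 2 P" and "2 \<le> j" "j \<le> k"
  shows "card (sidon_cliques S j {}) * (j * (j - 1)) * (1 - 1 / (4 * k)) ^ (j - 2)
    \<le> card (sidon_cliques S j P) * real ((card (carrier G))\<^sup>2)"
  using assms(2,3)
proof (induction j rule: dec_induct)
  case base
  have "card (sidon_cliques S 2 {}) \<le> card {A. A \<subseteq> carrier G \<and> card A = 2}"
    by (intro card_mono) (auto simp: sidon_cliques_def intro: finite_subset[of _ "Pow (carrier G)"])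
  also have "\<dots> = card (carrier G) choose 2" by (rule n_subsets) simp
  finally have "card (sidon_cliques S 2 {}) * 2 \<le> card (carrier G) * (card (carrier G) - 1) div 2 * 2"
    by (simp add: choose_two)
  also have "\<dots> \<le> card (carrier G) * (card (carrier G) - 1)" by simp
  also have "\<dots> \<le> (card (carrier G))\<^sup>2" by (simp add: power2_eq_square)
  finally have "card (sidon_cliques S 2 {}) * 2 \<le> (card (carrier G))\<^sup>2" .
  moreover have "card (sidon_cliques S 2 P) \<ge> 1"
    using P finite_sidon_cliques by (auto simp: Suc_le_eq card_gt_0_iff)
  ultimately have "card (sidon_cliques S 2 {}) * 2 \<le> card (sidon_cliques S 2 P) * (card (carrier G))\<^sup>2"
    by (metis mult_1 mult_le_mono1 order_trans)
  then show ?case by (simp flip: of_nat_mult of_nat_power)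
next
  case (step j)
  let ?M = "card (carrier G) / 2 ^ j"
  let ?\<theta> = "1 - 1 / (4 * real k)"
  let ?N2 = "real ((card (carrier G))\<^sup>2)"
  let ?q = "\<lambda>j. real (card (sidon_cliques S j {}))" and ?p = "\<lambda>j. real (card (sidon_cliques S j P))"
  have k: "real k \<ge> 2" using k_ge_2 by simp
  have \<theta>: "0 \<le> ?\<theta>" using k by simp
  have P2: "card P = 2" using P by (auto simp: sidon_cliques_def)
  have IH: "?q j * (j * (j - 1)) * ?\<theta> ^ (j - 2) \<le> ?p j * ?N2" using step by simp
  \<comment> \<open>The loss 3 / (12 k) = 1 / (4 k) covers the upper error 1 / (12 k) together with
    the lower error 2 / (12 k).\<close>
  have "?\<theta> * (1 + 1 / (12 * k)) \<le> 1 - 2 / (12 * k)"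
    using k by (simp add: field_simps)
  then have \<theta>M: "?M * (1 + 1 / (12 * k)) * ?\<theta> \<le> ?M * (1 - 2 / (12 * k))"
    using mult_left_mono[of "?\<theta> * (1 + 1 / (12 * k))" "1 - 2 / (12 * k)" ?M] by (simp add: mult_ac)
  have "real (Suc j * card (sidon_cliques S (Suc j) {})) = (\<Sum>A\<in>sidon_cliques S j {}. real (card (extensions S A)))"
    using sum_card_extensions[of S j "{}"] by (metis card.empty diff_zero of_nat_sum)
  also have "\<dots> \<le> (\<Sum>A\<in>sidon_cliques S j {}. ?M * (1 + 1 / (12 * k)))"
    using step by (intro sum_mono card_extensions_bounds(1)) auto
  finally have q: "Suc j * ?q (Suc j) \<le> ?q j * (?M * (1 + 1 / (12 * k)))"
    unfolding of_nat_mult sum_constant .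
  have "real ((Suc j - 2) * card (sidon_cliques S (Suc j) P)) = (\<Sum>A\<in>sidon_cliques S j P. real (card (extensions S A)))"
    using sum_card_extensions[of S j P] P2 by (metis of_nat_sum)
  also have "\<dots> \<ge> (\<Sum>A\<in>sidon_cliques S j P. ?M * (1 - 2 / (12 * k)))"
    using step by (intro sum_mono card_extensions_bounds(2)) auto
  finally have "?p j * (?M * (1 - 2 / (12 * k))) \<le> real (Suc j - 2) * ?p (Suc j)"
    unfolding of_nat_mult sum_constant .
  moreover have "real (Suc j - 2) = real j - 1" using step by (simp add: of_nat_diff)
  ultimately have p: "?p j * (?M * (1 - 2 / (12 * k))) \<le> (real j - 1) * ?p (Suc j)" by simp
  have j1: "real (j - 1) = real j - 1" "real j - 1 > 0" using step by (auto simp: of_nat_diff)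
  have pw: "?\<theta> ^ (Suc j - 2) = ?\<theta> * ?\<theta> ^ (j - 2)"
  proof -
    have "Suc j - 2 = Suc (j - 2)" using step(1) by arith
    then show ?thesis by simp
  qed
  \<comment> \<open>Both sides carry the positive factor j - 1, cancelled at the end, so that
    \<open>q\<close> and \<open>p\<close> apply without division.\<close>
  have "(real j - 1) * (?q (Suc j) * (Suc j * (Suc j - 1)) * ?\<theta> ^ (Suc j - 2))
      = (Suc j * ?q (Suc j)) * (?\<theta> * ((j * (j - 1)) * ?\<theta> ^ (j - 2)))"
    unfolding pw of_nat_mult j1(1) diff_Suc_1 by (simp only: mult_ac)
  also have "\<dots> \<le> (?q j * (?M * (1 + 1 / (12 * k)))) * (?\<theta> * ((j * (j - 1)) * ?\<theta> ^ (j - 2)))"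
    using q \<theta> by (intro mult_right_mono) auto
  also have "\<dots> = (?M * (1 + 1 / (12 * k)) * ?\<theta>) * (?q j * (j * (j - 1)) * ?\<theta> ^ (j - 2))"
    by (simp add: mult_ac)
  also have "\<dots> \<le> (?M * (1 - 2 / (12 * k))) * (?p j * ?N2)"
  proof (rule mult_mono[OF \<theta>M IH])
    show "0 \<le> ?M * (1 - 2 / (12 * k))" using k by (intro mult_nonneg_nonneg) auto
    show "0 \<le> ?q j * (j * (j - 1)) * ?\<theta> ^ (j - 2)"
      using \<theta> by (intro mult_nonneg_nonneg zero_le_power) auto
  qed
  also have "\<dots> = (?p j * (?M * (1 - 2 / (12 * k)))) * ?N2" by (simp add: mult_ac)
  also have "\<dots> \<le> ((real j - 1) * ?p (Suc j)) * ?N2" using p by (rule mult_right_mono) simp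
  finally have "(real j - 1) * (?q (Suc j) * (Suc j * (Suc j - 1)) * ?\<theta> ^ (Suc j - 2))
     \<le> (real j - 1) * (?p (Suc j) * ?N2)" by (simp add: mult_ac)
  then show ?case using j1(2) by (subst (asm) mult_le_cancel_left_pos) auto
qed

end

section \<open>Singletons, greedy covers and concentration of common neighbourhoods\<close>

context finite_comm_group
begin

lemma sumset_pair:
  assumes "a \<in> carrier G" "b \<in> carrier G" "a \<noteq> b"
  shows "sumset G {a, b} = {a \<otimes> b}"
  using sumset_insert[of "{b}" a] assms by (auto simp: sumset_def)

lemma exists_sumset_singleton:
  assumes "a \<in> carrier G" "x \<in> carrier G" "a \<otimes> a \<noteq> x"
  shows "\<exists>A\<subseteq>carrier G. sumset G A = {x}"
proof -
  have "a \<otimes> (inv a \<otimes> x) = x" using assms by (simp add: m_assoc[symmetric])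
  moreover from this have "a \<noteq> inv a \<otimes> x" using assms(3) by auto
  ultimately show ?thesis
    using sumset_pair[of a "inv a \<otimes> x"] assms by (intro exI[of _ "{a, inv a \<otimes> x}"]) auto
qed

text \<open>Translation by \<open>g\<close> maps square roots of \<open>x\<close> injectively to
  elements whose square is x g^2, which differs from \<open>x\<close>.\<close>

lemma card_le_twice_card_nonroots:
  assumes "x \<in> carrier G" "g \<in> carrier G" "g \<otimes> g \<noteq> \<one>"
  shows "card (carrier G) \<le> 2 * card {a \<in> carrier G. a \<otimes> a \<noteq> x}"
proof -
  let ?Y = "{a \<in> carrier G. a \<otimes> a = x}" and ?X = "{a \<in> carrier G. a \<otimes> a \<noteq> x}"
  have "card ?Y \<le> card ?X"
  proof (rule card_inj_on_le[where f = "\<lambda>a. a \<otimes> g"])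
    show "inj_on (\<lambda>a. a \<otimes> g) ?Y" using assms by (intro inj_onI) auto
    show "(\<lambda>a. a \<otimes> g) ` ?Y \<subseteq> ?X"
    proof (intro image_subsetI CollectI conjI)
      fix a assume "a \<in> ?Y"
      then have a: "a \<in> carrier G" and ax: "a \<otimes> a = x" by auto
      show "a \<otimes> g \<in> carrier G" using a assms by auto
      have "a \<otimes> g \<otimes> (a \<otimes> g) = a \<otimes> a \<otimes> (g \<otimes> g)"
        using a assms(2) by (simp add: m_ac)
      then show "a \<otimes> g \<otimes> (a \<otimes> g) \<noteq> x" using ax assms by simp
    qed
  qed simp
  moreover have "card (?X \<union> ?Y) = card ?X + card ?Y" by (intro card_Un_disjoint) auto
  moreover have "?X \<union> ?Y = carrier G" by auto
  ultimately show ?thesis by simp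
qed

text \<open>Applying \<open>step\<close> to the part still uncovered multiplies its size by at most
  1 - \<rho> each time; keeping all sumsets inside \<open>T\<close> ensures that nothing else is
  covered.\<close>

lemma exists_iterated_cover:
  fixes \<rho> :: real
  assumes "T \<subseteq> carrier G" "\<rho> \<le> 1"
    and step: "\<And>U. U \<subseteq> T \<Longrightarrow> \<exists>A\<subseteq>carrier G. sumset G A \<subseteq> T \<and> \<rho> * card U \<le> card (sumset G A \<inter> U)"
  shows "\<exists>W\<subseteq>T. union_of_sumsets G r W \<and> card (T - W) \<le> (1 - \<rho>) ^ r * card T"
proof (induction r)
  case 0
  then show ?case using union_of_sumsets_empty by (intro exI[of _ "{}"]) auto
next
  case (Suc r)
  then obtain W where W: "W \<subseteq> T" "union_of_sumsets G r W" "card (T - W) \<le> (1 - \<rho>) ^ r * card T"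
    by blast
  obtain A where A: "A \<subseteq> carrier G" "sumset G A \<subseteq> T" "\<rho> * card (T - W) \<le> card (sumset G A \<inter> (T - W))"
    using step[of "T - W"] by auto
  have "finite (T - W)" using assms(1) finite_subset_carrier by auto
  then have "card (T - W - sumset G A \<inter> (T - W)) = card (T - W) - card (sumset G A \<inter> (T - W))"
      "card (sumset G A \<inter> (T - W)) \<le> card (T - W)"
    by (auto intro!: card_Diff_subset card_mono)
  moreover have "T - (W \<union> sumset G A) = T - W - sumset G A \<inter> (T - W)" by auto
  ultimately have "real (card (T - (W \<union> sumset G A))) = card (T - W) - real (card (sumset G A \<inter> (T - W)))"
    by (simp add: of_nat_diff)
  also have "\<dots> \<le> (1 - \<rho>) * card (T - W)" using A(3) by (simp add: left_diff_distrib)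
  also have "\<dots> \<le> (1 - \<rho>) * ((1 - \<rho>) ^ r * card T)" using W(3) assms(2) by (intro mult_left_mono) auto
  finally have "card (T - (W \<union> sumset G A)) \<le> (1 - \<rho>) ^ Suc r * card T" by simp
  moreover have "union_of_sumsets G (Suc r) (W \<union> sumset G A)"
    using union_of_sumsets_Un[OF W(2) union_of_sumsets_sumset[OF A(1)]] by simp
  ultimately show ?case using W(1) A(2) by (intro exI[of _ "W \<union> sumset G A"]) auto
qed

text \<open>Exchange the sums: an element \<open>y\<close> is counted when its translate of
  \<open>A\<close>, a set of |A| elements, lies in \<open>S\<close>, which has probability
  2^(-|A|).\<close>

lemma mean_card_common_nbhd:
  assumes "A \<subseteq> carrier G"
  shows "(\<Sum>S\<in>Pow (carrier G). real (card (common_nbhd S A))) / 2 ^ card (carrier G)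
    = card (carrier G) / 2 ^ card A"
proof -
  let ?V = "carrier G"
  let ?Z = "\<lambda>y. (\<lambda>a. y \<otimes> a) ` A"
  have card_Z: "card (?Z y) = card A" if "y \<in> ?V" for y
    using that assms by (intro card_image inj_onI) (metis Units_eq Units_l_cancel subsetD)
  have "(\<Sum>S\<in>Pow ?V. card (common_nbhd S A)) = (\<Sum>S\<in>Pow ?V. card {y \<in> ?V. ?Z y \<subseteq> S})"
    by (intro sum.cong arg_cong[where f = card]) (auto simp: common_nbhd_def)
  also have "\<dots> = (\<Sum>y\<in>?V. card {S \<in> Pow ?V. ?Z y \<subseteq> S})"
    using sum.swap_restrict[of "Pow ?V" ?V "\<lambda>_ _. 1::nat" "\<lambda>S y. ?Z y \<subseteq> S"] by simp
  finally have "(\<Sum>S\<in>Pow ?V. real (card (common_nbhd S A)))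
    = (\<Sum>y\<in>?V. real (card {S \<in> Pow ?V. ?Z y \<subseteq> S}))"
    unfolding of_nat_sum[symmetric] by (rule arg_cong)
  also have "\<dots> / 2 ^ card ?V = (\<Sum>y\<in>?V. (1 / 2) ^ card A)"
    unfolding sum_divide_distrib
  proof (rule sum.cong)
    fix y assume y: "y \<in> ?V"
    have "card {S \<in> Pow ?V. ?Z y \<subseteq> S} / 2 ^ card ?V = (1 / 2) ^ card (?Z y)"
      using prob_superset[of ?V "?Z y"] prob_random_subset[of ?V "{S. ?Z y \<subseteq> S}"] y assms by auto
    then show "card {S \<in> Pow ?V. ?Z y \<subseteq> S} / 2 ^ card ?V = (1 / 2) ^ card A"
      using card_Z[OF y] by simp
  qed simp
  finally show ?thesis by (simp add: power_divide)
qed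

text \<open>Adding \<open>z\<close> to \<open>S\<close> can only bring in elements z a^(-1) with a
  in \<open>A\<close>. This is the difference bound for the concentration inequality.\<close>

lemma card_common_nbhd_insert:
  assumes "A \<subseteq> carrier G" "z \<in> carrier G"
  shows "\<bar>real (card (common_nbhd (insert z S) A)) - card (common_nbhd S A)\<bar> \<le> card A"
proof -
  let ?E = "(\<lambda>a. z \<otimes> inv a) ` A"
  have finA: "finite A" using assms finite_subset_carrier by auto
  have "common_nbhd (insert z S) A \<subseteq> common_nbhd S A \<union> ?E"
  proof
    fix y assume y: "y \<in> common_nbhd (insert z S) A"
    then have yc: "y \<in> carrier G" by (auto simp: common_nbhd_def)
    show "y \<in> common_nbhd S A \<union> ?E"
    proof (cases "\<exists>a\<in>A. y \<otimes> a = z")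
      case True
      then obtain a where "a \<in> A" "y \<otimes> a = z" by auto
      moreover from this have "y = z \<otimes> inv a" using yc assms by (metis inv_solve_right subsetD)
      ultimately show ?thesis by auto
    next
      case False
      then show ?thesis using y by (auto simp: common_nbhd_def)
    qed
  qed
  then have "card (common_nbhd (insert z S) A) \<le> card (common_nbhd S A \<union> ?E)"
    using finA finite_common_nbhd by (intro card_mono) auto
  also have "\<dots> \<le> card (common_nbhd S A) + card ?E" by (rule card_Un_le)
  also have "\<dots> \<le> card (common_nbhd S A) + card A" using finA by (intro add_left_mono card_image_le)
  finally have "card (common_nbhd (insert z S) A) \<le> card (common_nbhd S A) + card A" .
  moreover have "card (common_nbhd S A) \<le> card (common_nbhd (insert z S) A)"
    using finite_common_nbhd by (intro card_mono) (auto simp: common_nbhd_def)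
  ultimately show ?thesis by linarith
qed

text \<open>Bounded differences with c = |A| and t = N / (12 k 2^|A|) give the exponent N / (72 *
  4^|A| k^2 |A|^2), which is smallest at |A| = k. A union bound over \<open>A\<close>
  follows.\<close>

lemma prob_common_nbhd_deviation_le:
  assumes "k \<ge> 1"
  shows "measure_pmf.prob (pmf_of_set (Pow (carrier G)))
     {S. \<exists>A. A \<subseteq> carrier G \<and> A \<noteq> {} \<and> card A \<le> k \<and>
       \<bar>card (common_nbhd S A) - card (carrier G) / 2 ^ card A\<bar> \<ge> card (carrier G) / 2 ^ card A / (12 * k)}
    \<le> (card (carrier G) + 1) ^ k * (2 * exp (- (card (carrier G) / (72 * 4 ^ k * k ^ 4))))"
proof -
  let ?P = "measure_pmf.prob (pmf_of_set (Pow (carrier G)))"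
  let ?N = "card (carrier G)"
  let ?I = "{A. A \<subseteq> carrier G \<and> A \<noteq> {} \<and> card A \<le> k}"
  let ?t = "\<lambda>A :: 'a set. ?N / 2 ^ card A / (12 * k)"
  let ?e = "2 * exp (- (?N / (72 * 4 ^ k * k ^ 4)))"
  have N: "?N > 0" by (rule card_carrier_pos)
  have finI: "finite ?I" by (auto intro: finite_subset[of _ "Pow (carrier G)"])
  have one: "?P {S. \<bar>card (common_nbhd S A) - ?N / 2 ^ card A\<bar> \<ge> ?t A} \<le> ?e" if A: "A \<in> ?I" for A
  proof -
    have Ac: "A \<subseteq> carrier G" "card A > 0" "card A \<le> k"
      using A finite_subset_carrier[of A] by (auto simp: card_gt_0_iff)
    have "?P {S. \<bar>card (common_nbhd S A) - ?N / 2 ^ card A\<bar> \<ge> ?t A}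
      \<le> 2 * exp (- 2 * (?t A)\<^sup>2 / ((card A)\<^sup>2 * ?N))"
      using prob_dist_mean_le[of "carrier G" "card A" "?t A" "\<lambda>S. card (common_nbhd S A)" "?N / 2 ^ card A"]
        Ac N card_common_nbhd_insert[OF Ac(1)] mean_card_common_nbhd[OF Ac(1)] by auto
    also have "\<dots> \<le> ?e"
    proof -
      have "72 * 4 ^ card A * k\<^sup>2 * (card A)\<^sup>2 \<le> 72 * 4 ^ k * k\<^sup>2 * k\<^sup>2"
        using Ac(3) by (intro mult_mono power_mono power_increasing) auto
      then have le: "real (72 * 4 ^ card A * k\<^sup>2 * (card A)\<^sup>2) \<le> real (72 * 4 ^ k * k\<^sup>2 * k\<^sup>2)"
        by (simp only: of_nat_le_iff)
      have "?N / (72 * 4 ^ k * k ^ 4) = ?N / real (72 * 4 ^ k * k\<^sup>2 * k\<^sup>2)"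
        by (simp add: power2_eq_square power4_eq_xxxx mult_ac)
      also have "\<dots> \<le> ?N / real (72 * 4 ^ card A * k\<^sup>2 * (card A)\<^sup>2)"
        using le assms Ac by (intro divide_left_mono) auto
      also have "\<dots> = 2 * (?t A)\<^sup>2 / ((card A)\<^sup>2 * ?N)"
      proof -
        have "(4::real) ^ card A = (2 ^ card A)\<^sup>2" by (simp add: power2_eq_square flip: power_mult_distrib)
        then show ?thesis using N Ac assms by (simp add: field_simps power2_eq_square)
      qed
      finally show ?thesis by simp
    qed
    finally show ?thesis .
  qed
  have "?P {S. \<exists>A\<in>?I. \<bar>card (common_nbhd S A) - ?N / 2 ^ card A\<bar> \<ge> ?t A} \<le> (\<Sum>A\<in>?I. ?e)"
    by (rule prob_Bex_le[OF finI one])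
  also have "\<dots> = card ?I * ?e" by simp
  also have "\<dots> \<le> real ((?N + 1) ^ k) * ?e"
  proof (rule mult_right_mono)
    have "card ?I \<le> card {A. A \<subseteq> carrier G \<and> card A \<le> k}"
      by (intro card_mono) (auto intro: finite_subset[of _ "Pow (carrier G)"])
    also have "\<dots> \<le> (?N + 1) ^ k" by (rule card_subsets_card_le) simp
    finally show "real (card ?I) \<le> real ((?N + 1) ^ k)" by (simp only: of_nat_le_iff)
  qed simp
  finally show ?thesis by (simp add: conj_ac)
qed

end

section \<open>Covering a pseudorandom set by sumsets\<close>

context pseudorandom_set
begin

text \<open>At least N / 2 elements \<open>a\<close> give a proper pair {a, a^(-1) x} with product
  \<open>x\<close>, and each pair lies in a proportion of order k^2 / N^2 of the cliques. The weak
  Sidon property prevents overcounting: a clique contains at most one such pair, hence is counted at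
  most twice.\<close>

lemma card_sidon_cliques_covering:
  assumes x: "x \<in> S" "x \<in> carrier G" and half: "card (carrier G) \<le> 2 * card {a \<in> carrier G. a \<otimes> a \<noteq> x}"
  shows "card (sidon_cliques S k {}) * k\<^sup>2
    \<le> 20 * card (carrier G) * card {A \<in> sidon_cliques S k {}. x \<in> sumset G A}"
proof -
  let ?N = "card (carrier G)"
  let ?X = "{a \<in> carrier G. a \<otimes> a \<noteq> x}"
  let ?P = "\<lambda>a. {a, inv a \<otimes> x}"
  let ?Q = "{A \<in> sidon_cliques S k {}. x \<in> sumset G A}"
  let ?q = "card (sidon_cliques S k {})"
  have finQ: "finite ?Q" using finite_sidon_cliques by auto
  have a: "a \<in> carrier G" "inv a \<otimes> x \<in> carrier G" "a \<otimes> (inv a \<otimes> x) = x" "a \<noteq> inv a \<otimes> x" if "a \<in> ?X" for a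
  proof -
    show "a \<in> carrier G" "inv a \<otimes> x \<in> carrier G" using that x by auto
    show *: "a \<otimes> (inv a \<otimes> x) = x" using that x by (simp add: m_assoc[symmetric])
    show "a \<noteq> inv a \<otimes> x" using that * by auto
  qed
  have PQ: "sidon_cliques S k (?P a) = {A \<in> ?Q. ?P a \<subseteq> A}" if "a \<in> ?X" for a
  proof -
    have "x \<in> sumset G A" if "?P a \<subseteq> A" for A
      using that a[OF \<open>a \<in> ?X\<close>] unfolding sumset_def by (intro CollectI exI[of _ a] exI[of _ "inv a \<otimes> x"]) auto
    then show ?thesis by (auto simp: sidon_cliques_def)
  qed
  have Pa: "?P a \<in> sidon_cliques S 2 (?P a)" if "a \<in> ?X" for a
  proof -
    have "weak_sidon (?P a)" unfolding weak_sidon_def by auto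
    then show ?thesis
      using a[OF that] x sumset_pair[of a "inv a \<otimes> x"] by (auto simp: sidon_cliques_def)
  qed
  have mult: "card {a \<in> ?X. ?P a \<subseteq> A} \<le> 2" if "A \<in> ?Q" for A
  proof -
    have "x \<in> sumset G A" using that by simp
    then obtain c d where cd: "c \<in> A" "d \<in> A" "c \<noteq> d" "c \<otimes> d = x"
      unfolding sumset_def by blast
    have ws: "weak_sidon A" using that by (simp add: sidon_cliques_def)
    have "{a \<in> ?X. ?P a \<subseteq> A} \<subseteq> {c, d}"
    proof
      fix a' assume a': "a' \<in> {a \<in> ?X. ?P a \<subseteq> A}"
      then have "a' \<in> ?X" "a' \<in> A" "inv a' \<otimes> x \<in> A" by auto
      then have "?P a' = {c, d}"
        using a[of a'] cd by (intro ws[unfolded weak_sidon_def, rule_format]) auto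
      then show "a' \<in> {c, d}" by auto
    qed
    then have "card {a \<in> ?X. ?P a \<subseteq> A} \<le> card {c, d}" by (intro card_mono) auto
    also have "\<dots> \<le> 2" by (simp add: card_insert_if)
    finally show ?thesis .
  qed
  have "(\<Sum>a\<in>?X. card (sidon_cliques S k (?P a))) = (\<Sum>a\<in>?X. card {A \<in> ?Q. ?P a \<subseteq> A})"
    using PQ by (intro sum.cong) auto
  also have "\<dots> = (\<Sum>A\<in>?Q. card {a \<in> ?X. ?P a \<subseteq> A})"
    using sum.swap_restrict[of ?X ?Q "\<lambda>_ _. 1::nat" "\<lambda>a A. ?P a \<subseteq> A"] finQ by simp
  also have "\<dots> \<le> (\<Sum>A\<in>?Q. 2)" using mult by (rule sum_mono)
  finally have upper: "(\<Sum>a\<in>?X. card (sidon_cliques S k (?P a))) \<le> 2 * card ?Q" by (simp add: mult.commute)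
  have k: "real k \<ge> 2" using k_ge_2 by simp
  \<comment> \<open>Bernoulli's inequality: k - 2 losses of 1 / (4 k) total at most 1 / 4.\<close>
  have "3 / 4 \<le> 1 + (k - 2) * (- 1 / (4 * real k))"
    using k by (simp add: field_simps of_nat_diff)
  also have "\<dots> \<le> (1 + - 1 / (4 * real k)) ^ (k - 2)"
    using k by (intro Bernoulli_inequality) (simp add: field_simps)
  finally have \<theta>: "3 / 4 \<le> (1 - 1 / (4 * real k)) ^ (k - 2)" by simp
  have k2: "(real k)\<^sup>2 / 2 \<le> real (k * (k - 1))"
    using k by (simp add: of_nat_diff power2_eq_square field_simps)
  have "?q * (real k)\<^sup>2 * (3 / 8) = ?q * ((real k)\<^sup>2 / 2) * (3 / 4)" by simp
  also have "\<dots> \<le> ?q * real (k * (k - 1)) * (1 - 1 / (4 * real k)) ^ (k - 2)"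
    using k2 \<theta> by (intro mult_mono) auto
  finally have low: "?q * (real k)\<^sup>2 * (3 / 8) \<le> ?q * real (k * (k - 1)) * (1 - 1 / (4 * real k)) ^ (k - 2)" .
  have "real ?N * (?q * (real k)\<^sup>2 * (3 / 8)) \<le> real (2 * card ?X) * (?q * (real k)\<^sup>2 * (3 / 8))"
    using half by (intro mult_right_mono) (simp_all only: of_nat_le_iff, simp)
  also have "\<dots> = 2 * (\<Sum>a\<in>?X. ?q * (real k)\<^sup>2 * (3 / 8))" by simp
  also have "\<dots> \<le> 2 * (\<Sum>a\<in>?X. card (sidon_cliques S k (?P a)) * real (?N\<^sup>2))"
  proof (intro mult_left_mono sum_mono)
    fix a assume "a \<in> ?X"
    note low
    also have "?q * real (k * (k - 1)) * (1 - 1 / (4 * real k)) ^ (k - 2)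
        = (?q * (k * (k - 1))) * (1 - 1 / (4 * k)) ^ (k - 2)" by simp
    also note card_sidon_cliques_containing_pair[OF Pa[OF \<open>a \<in> ?X\<close>] k_ge_2 order_refl]
    finally show "?q * (real k)\<^sup>2 * (3 / 8) \<le> card (sidon_cliques S k (?P a)) * real (?N\<^sup>2)" .
  qed simp
  also have "\<dots> = 2 * (real (\<Sum>a\<in>?X. card (sidon_cliques S k (?P a))) * real (?N\<^sup>2))"
    by (simp add: sum_distrib_right)
  also have "\<dots> \<le> 2 * (real (2 * card ?Q) * real (?N\<^sup>2))"
    by (intro mult_left_mono mult_right_mono of_nat_mono upper) auto
  finally have "real ?N * (?q * (real k)\<^sup>2 * (3 / 8)) \<le> real ?N * (4 * card ?Q * ?N)"
    by (simp add: power2_eq_square mult_ac)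
  then have "?q * (real k)\<^sup>2 * (3 / 8) \<le> real (4 * card ?Q * ?N)"
    using card_carrier_pos by simp
  also have "\<dots> = 4 * (real (card ?Q) * ?N)" by simp
  finally have "?q * (real k)\<^sup>2 * (3 / 8) \<le> 4 * (real (card ?Q) * ?N)" .
  moreover have "0 \<le> real (card ?Q) * ?N" by simp
  \<comment> \<open>The constants give 32 / 3, rounded up to 20.\<close>
  ultimately have "?q * (real k)\<^sup>2 \<le> 20 * (real (card ?Q) * ?N)" by linarith
  then have "real (?q * k\<^sup>2) \<le> real (20 * ?N * card ?Q)" by (simp add: mult_ac)
  then show ?thesis by (simp only: of_nat_le_iff)
qed

text \<open>Averaging: every \<open>x\<close> in \<open>U\<close> is covered by a proportion k^2 /
  (20 N) of the cliques, so some clique covers at least this proportion of \<open>U\<close>.\<close>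

lemma exists_sumset_covering:
  assumes U: "U \<subseteq> S" "U \<subseteq> carrier G"
    and half: "\<And>x. x \<in> U \<Longrightarrow> card (carrier G) \<le> 2 * card {a \<in> carrier G. a \<otimes> a \<noteq> x}"
  shows "\<exists>A\<subseteq>carrier G. sumset G A \<subseteq> S \<and> card U * k\<^sup>2 \<le> 20 * card (carrier G) * card (sumset G A \<inter> U)"
proof (rule ccontr)
  assume neg: "\<not> ?thesis"
  let ?N = "card (carrier G)"
  let ?F = "sidon_cliques S k {}"
  have finU: "finite U" using U finite_subset_carrier by auto
  have q: "card ?F > 0" using k_ge_2 by (intro card_sidon_cliques_pos) auto
  have "(\<Sum>x\<in>U. card ?F * k\<^sup>2) \<le> (\<Sum>x\<in>U. 20 * ?N * card {A \<in> ?F. x \<in> sumset G A})"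
    using U half by (intro sum_mono card_sidon_cliques_covering) auto
  also have "\<dots> = 20 * ?N * (\<Sum>x\<in>U. card {A \<in> ?F. x \<in> sumset G A})"
    by (simp add: sum_distrib_left)
  also have "(\<Sum>x\<in>U. card {A \<in> ?F. x \<in> sumset G A}) = (\<Sum>A\<in>?F. card {x \<in> U. x \<in> sumset G A})"
    using sum.swap_restrict[of U ?F "\<lambda>_ _. 1::nat" "\<lambda>x A. x \<in> sumset G A"] finU finite_sidon_cliques by simp
  also have "\<dots> = (\<Sum>A\<in>?F. card (sumset G A \<inter> U))"
    by (intro sum.cong arg_cong[where f = card]) auto
  also have "20 * ?N * (\<Sum>A\<in>?F. card (sumset G A \<inter> U)) = (\<Sum>A\<in>?F. 20 * ?N * card (sumset G A \<inter> U))"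
    by (simp add: sum_distrib_left)
  also have "\<dots> < (\<Sum>A\<in>?F. card U * k\<^sup>2)"
  proof (rule sum_strict_mono)
    show "20 * ?N * card (sumset G A \<inter> U) < card U * k\<^sup>2" if "A \<in> ?F" for A
    proof -
      have "A \<subseteq> carrier G" "sumset G A \<subseteq> S" using that by (auto simp: sidon_cliques_def)
      then show ?thesis using neg by (meson not_le)
    qed
  qed (use q finite_sidon_cliques in \<open>auto simp: card_gt_0_iff\<close>)
  finally show False by (simp add: mult_ac)
qed

text \<open>After \<open>r\<close> greedy rounds the elements left over are covered one by one. In
  exponent at most 2 the identity lies in no sumset, so a sumset inside \<open>S\<close> is
  automatically inside \<open>T\<close>.\<close>

lemma union_of_few_sumsets:
  fixes r :: nat
  assumes "S \<subseteq> carrier G"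
  defines "T \<equiv> if \<exists>g\<in>carrier G. g \<otimes> g \<noteq> \<one> then S else S - {\<one>}"
  shows "\<exists>m. union_of_sumsets G m T \<and>
    real m \<le> r + exp (- (r * (k\<^sup>2 / (20 * real (card (carrier G)))))) * card (carrier G)"
proof -
  let ?N = "card (carrier G)"
  let ?\<rho> = "k\<^sup>2 / (20 * real ?N)"
  have N: "?N > 0" by (rule card_carrier_pos)
  have T: "T \<subseteq> S" "T \<subseteq> carrier G" using assms by (auto split: if_splits)
  have half: "?N \<le> 2 * card {a \<in> carrier G. a \<otimes> a \<noteq> x}" if "x \<in> T" for x
  proof (cases "\<exists>g\<in>carrier G. g \<otimes> g \<noteq> \<one>")
    case True
    then show ?thesis using card_le_twice_card_nonroots[of x] that T by blast
  next
    case False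
    \<comment> \<open>Here every square is the identity, which \<open>T\<close> omits, so no element
      squares to \<open>x\<close>.\<close>
    then have "{a \<in> carrier G. a \<otimes> a \<noteq> x} = carrier G" using that by (auto simp: T_def)
    then show ?thesis by simp
  qed
  have sub: "sumset G A \<subseteq> T" if "A \<subseteq> carrier G" "sumset G A \<subseteq> S" for A
  proof (cases "\<exists>g\<in>carrier G. g \<otimes> g \<noteq> \<one>")
    case False
    then have "\<one> \<notin> sumset G A" using that by (intro one_notin_sumset) (auto intro: comm_group_axioms)
    then show ?thesis using that False by (auto simp: T_def)
  qed (use that in \<open>simp add: T_def\<close>)
  \<comment> \<open>\<open>k_small\<close> forces k^2 <= N, so the decay ratio
    \<open>1 - ?\<rho>\<close> is nonnegative.\<close>
  have "real (k\<^sup>2) \<le> 20 * real ?N"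
  proof -
    have "real (k\<^sup>2) \<le> real (k + k ^ 3)"
      using k_ge_2 power_increasing[of 2 3 k] by (simp only: of_nat_le_iff) linarith
    also have "\<dots> \<le> ?N / 2 ^ k / (12 * k)" using k_small by simp
    also have "\<dots> \<le> ?N / 1 / 1"
      using k_ge_2 by (intro frac_le) auto
    finally show ?thesis by linarith
  qed
  then have \<rho>: "?\<rho> \<le> 1" using N by simp
  have "\<exists>A\<subseteq>carrier G. sumset G A \<subseteq> T \<and> ?\<rho> * card U \<le> card (sumset G A \<inter> U)" if "U \<subseteq> T" for U
  proof -
    have "U \<subseteq> S" "U \<subseteq> carrier G" using that T by auto
    moreover have "?N \<le> 2 * card {a \<in> carrier G. a \<otimes> a \<noteq> x}" if "x \<in> U" for x
      using that \<open>U \<subseteq> T\<close> half by blast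
    ultimately have "\<exists>A\<subseteq>carrier G. sumset G A \<subseteq> S \<and> card U * k\<^sup>2 \<le> 20 * ?N * card (sumset G A \<inter> U)"
      by (rule exists_sumset_covering)
    then obtain A where A: "A \<subseteq> carrier G" "sumset G A \<subseteq> S" "card U * k\<^sup>2 \<le> 20 * ?N * card (sumset G A \<inter> U)"
      by (elim exE conjE)
    from A(3) have "real (card U * k\<^sup>2) \<le> real (20 * ?N * card (sumset G A \<inter> U))"
      by (simp only: of_nat_le_iff)
    then have "?\<rho> * card U \<le> card (sumset G A \<inter> U)" using N by (simp add: field_simps)
    then show ?thesis using A sub by blast
  qed
  from exists_iterated_cover[OF T(2) \<rho> this, of r]
  obtain W where W: "W \<subseteq> T" "union_of_sumsets G r W" "card (T - W) \<le> (1 - ?\<rho>) ^ r * card T" by blast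
  have "union_of_sumsets G (card (T - W)) (T - W)"
  proof (rule union_of_sumsets_card)
    show "finite (T - W)" using T finite_subset_carrier by auto
    fix x assume x: "x \<in> T - W"
    then have "{a \<in> carrier G. a \<otimes> a \<noteq> x} \<noteq> {}" using half[of x] N by (auto simp del: Collect_empty_eq)
    then show "\<exists>A\<subseteq>carrier G. sumset G A = {x}" using x T exists_sumset_singleton by blast
  qed
  then have un: "union_of_sumsets G (r + card (T - W)) T"
    using union_of_sumsets_Un[OF W(2)] W(1) by (metis Diff_partition)
  have "card T \<le> ?N" using T by (intro card_mono) auto
  then have "(1 - ?\<rho>) ^ r * card T \<le> exp (- ?\<rho>) ^ r * ?N"
    using \<rho> exp_ge_add_one_self[of "- ?\<rho>"] by (intro mult_mono power_mono) auto
  also have "exp (- ?\<rho>) ^ r = exp (- (r * ?\<rho>))"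
    by (simp only: exp_of_nat_mult[symmetric] mult_minus_right)
  finally have "real (r + card (T - W)) \<le> r + exp (- (r * ?\<rho>)) * ?N" using W(3) by simp
  with un show ?thesis by (intro exI[of _ "r + card (T - W)"] conjI)
qed

end

section \<open>The number of sumsets\<close>

context finite_comm_group
begin

text \<open>Deterministic part of the lower bound: sparsity first bounds |A| by the greedy lemma,
  then supplies a core \<open>B\<close> of size at most 2 b, so that \<open>A\<close> falls under
  \<open>small\<close>.\<close>

lemma card_sumset_less:
  fixes x :: real
  assumes "x > 0" "20 * x \<le> b" "b\<^sup>2 \<le> s"
    and sparse: "\<And>B. B \<subseteq> carrier G \<Longrightarrow> B \<noteq> {} \<Longrightarrow> sumset G B \<subseteq> S \<Longrightarrow> card (sumset G B) < 5 * x * card B"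
    and small: "\<And>B A. B \<subseteq> carrier G \<Longrightarrow> B \<noteq> {} \<Longrightarrow> card B \<le> 2 * b \<Longrightarrow> A \<subseteq> B \<union> mostly_covered B \<Longrightarrow>
      card A \<le> 3 * (b + 1)\<^sup>2 \<Longrightarrow> sumset G A \<subseteq> S \<Longrightarrow> card (sumset G A) < s"
    and A: "A \<subseteq> carrier G" "sumset G A \<subseteq> S"
  shows "card (sumset G A) < s"
proof (rule ccontr)
  assume "\<not> ?thesis"
  then have s: "s \<le> card (sumset G A)" by simp
  have sub: "card (sumset G B) < 5 * x * card B" if "B \<subseteq> A" "B \<noteq> {}" for B
    using that A sumset_mono[OF that(1)] by (intro sparse) auto
  have "card A < 3 * (b + 1)\<^sup>2"
  proof (rule ccontr)
    assume "\<not> ?thesis"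
    \<comment> \<open>With b + 1 elements there are at least b (b + 1) / 4 sums, whereas sparsity
      allows fewer than 5 x (b + 1) <= b (b + 1) / 4.\<close>
    then obtain A' where A': "A' \<subseteq> A" "card A' = b + 1" "(b + 1) * (b + 1 - 1) \<le> 4 * card (sumset G A')"
      using exists_subset_large_sumset[OF A(1), of "b + 1"] by auto
    have "real ((b + 1) * b) \<le> real (4 * card (sumset G A'))" using A'(3) by (simp only: of_nat_le_iff) simp
    also have "\<dots> < 4 * (5 * x * card A')" using sub[of A'] A' by fastforce
    also have "\<dots> = (20 * x) * real (b + 1)" by (simp add: A'(2))
    also have "\<dots> \<le> b * real (b + 1)" using assms(2) by (intro mult_right_mono) auto
    finally show False by (simp only: of_nat_mult mult.commute less_irrefl)
  qed
  moreover have "b \<le> card A"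
  proof -
    \<comment> \<open>At least b^2 sums need at least \<open>b\<close> summands, which is the size
      required for a core.\<close>
    have "b\<^sup>2 \<le> (card A)\<^sup>2" using assms(3) s card_sumset_le[OF A(1)] by linarith
    then show ?thesis by (simp add: power2_nat_le_eq_le)
  qed
  then obtain B where "B \<subseteq> A" "B \<noteq> {}" "card B \<le> 2 * b" "A \<subseteq> B \<union> mostly_covered B"
    using exists_core[OF A(1) assms(1) _ assms(2)] sub by blast
  ultimately show False using small[of B A] A s by fastforce
qed

text \<open>Dense sumsets and large sumsets with a core fail with probability at most 1 / N each.
  With y = ln x, the choices of \<open>B\<close> and \<open>A\<close> add at most 84 x^2 and 4356
  x^2 y to the exponent of the second bound; the factor 2^(-s) adds at most -6000 x^2 y, leaving at
  most -x.\<close>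

lemma prob_large_sumset_le:
  fixes x :: real
  defines "x \<equiv> ln (card (carrier G))"
  defines "b \<equiv> nat \<lceil>20 * x\<rceil>" and "s \<equiv> nat \<lceil>10000 * x\<^sup>2 * ln x\<rceil>"
  assumes x: "x \<ge> 7056"
  shows "measure_pmf.prob (pmf_of_set (Pow (carrier G)))
    {S. \<exists>A. A \<subseteq> carrier G \<and> sumset G A \<subseteq> S \<and> s \<le> card (sumset G A)} \<le> 2 / card (carrier G)"
proof -
  let ?N = "card (carrier G)" and ?P = "measure_pmf.prob (pmf_of_set (Pow (carrier G)))"
  let ?n = "3 * (b + 1)\<^sup>2"
  have N0: "?N > 0" by (rule card_carrier_pos)
  have expx: "exp x = ?N" using N0 by (simp add: x_def)
  have N: "?N \<ge> 2"
    using x N0 unfolding x_def by (metis One_nat_def Suc_1 Suc_leI antisym_conv2 le_numeral_extra(4) ln_one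
      not_numeral_le_zero of_nat_1 Suc_lessI)
  define y where "y = ln x"
  have y: "y \<ge> 1"
  proof -
    have "exp 1 \<le> x" using x exp_le by simp
    then show ?thesis unfolding y_def using x by (subst ln_ge_iff) auto
  qed
  have b: "20 * x \<le> b" "real b \<le> 21 * x" using x unfolding b_def by linarith+
  have s: "10000 * (x\<^sup>2 * y) \<le> s" unfolding s_def y_def using real_nat_ceiling_ge by (simp add: mult_ac)
  have "real (b\<^sup>2) \<le> (21 * x)\<^sup>2" unfolding of_nat_power using b(2) by (rule power_mono) simp
  also have "\<dots> \<le> 10000 * (x\<^sup>2 * y)"
    using y x mult_left_mono[of 1 y "x\<^sup>2"] by (simp add: power_mult_distrib)
  finally have bs: "b\<^sup>2 \<le> s" using s by linarith
  let ?E1 = "{S. \<exists>B. B \<subseteq> carrier G \<and> B \<noteq> {} \<and> 5 * ln ?N * card B \<le> card (sumset G B) \<and> sumset G B \<subseteq> S}"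
  let ?E2 = "{S. \<exists>B A. B \<subseteq> carrier G \<and> B \<noteq> {} \<and> card B \<le> 2 * b \<and> A \<subseteq> B \<union> mostly_covered B \<and>
      card A \<le> ?n \<and> s \<le> card (sumset G A) \<and> sumset G A \<subseteq> S}"
  have "{S. \<exists>A. A \<subseteq> carrier G \<and> sumset G A \<subseteq> S \<and> s \<le> card (sumset G A)} \<subseteq> ?E1 \<union> ?E2"
  proof
    fix S assume "S \<in> {S. \<exists>A. A \<subseteq> carrier G \<and> sumset G A \<subseteq> S \<and> s \<le> card (sumset G A)}"
    then obtain A where A: "A \<subseteq> carrier G" "sumset G A \<subseteq> S" "s \<le> card (sumset G A)" by blast
    show "S \<in> ?E1 \<union> ?E2"
    proof (rule ccontr)
      assume "S \<notin> ?E1 \<union> ?E2"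
      then have n1: "S \<notin> ?E1" and n2: "S \<notin> ?E2" by blast+
      have "card (sumset G A) < s"
      proof (rule card_sumset_less[OF _ b(1) bs _ _ A(1,2)])
        show "x > 0" using x by simp
        show "card (sumset G B) < 5 * x * card B" if "B \<subseteq> carrier G" "B \<noteq> {}" "sumset G B \<subseteq> S" for B
          using n1 that unfolding x_def mem_Collect_eq by (meson not_le)
        show "card (sumset G A) < s" if "B \<subseteq> carrier G" "B \<noteq> {}" "card B \<le> 2 * b"
          "A \<subseteq> B \<union> mostly_covered B" "card A \<le> ?n" "sumset G A \<subseteq> S" for B A
          using n2 that unfolding mem_Collect_eq by (meson not_le)
      qed
      then show False using A(3) by simp
    qed
  qed
  then have "?P {S. \<exists>A. A \<subseteq> carrier G \<and> sumset G A \<subseteq> S \<and> s \<le> card (sumset G A)} \<le> ?P (?E1 \<union> ?E2)"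
    by (intro measure_pmf.finite_measure_mono) auto
  also have "\<dots> \<le> ?P ?E1 + ?P ?E2" by (intro measure_Un_le) auto
  also have "?P ?E1 \<le> 1 / ?N" by (rule prob_dense_sumset_le[OF N])
  also have "?P ?E2 \<le> 1 / ?N"
  proof -
    have b1: "2 * b \<ge> 1" using b x by linarith
    have "?P ?E2 \<le> (?N + 1) ^ (2 * b) * (4 * (2 * b)\<^sup>2) ^ ?n * (1 / 2) ^ s"
      by (rule prob_large_sumset_of_cored_set_le[OF b1])
    also have "\<dots> = exp (ln (?N + 1)) ^ (2 * b) * exp (ln (4 * (2 * b)\<^sup>2)) ^ ?n * exp (- ln 2) ^ s"
      using b1 by (simp add: exp_minus inverse_eq_divide)
    also have "\<dots> = exp (real (2 * b) * ln (?N + 1) + real ?n * ln (4 * (2 * b)\<^sup>2) - s * ln 2)"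
      unfolding exp_of_nat_mult[symmetric] exp_add[symmetric] by simp
    also have "\<dots> \<le> exp (- x)"
    proof -
      have "?N + 1 \<le> ?N\<^sup>2" using N mult_le_mono1[of 2 ?N ?N] unfolding power2_eq_square by linarith
      then have le: "real (?N + 1) \<le> real (?N\<^sup>2)" by (rule of_nat_mono)
      moreover have "0 < real (?N + 1)" by simp
      ultimately have "0 < real (?N\<^sup>2)" by linarith
      with le have "ln (?N + 1) \<le> ln (real (?N\<^sup>2))"
        by (simp only: ln_le_cancel_iff \<open>0 < real (?N + 1)\<close>)
      also have "\<dots> = 2 * x" using N0 by (simp add: x_def ln_realpow)
      finally have "real (2 * b) * ln (?N + 1) \<le> (42 * x) * (2 * x)"
        using b x by (intro mult_mono) auto
      also have "\<dots> = 84 * x\<^sup>2" by (simp add: power2_eq_square)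
      finally have t1: "real (2 * b) * ln (?N + 1) \<le> 84 * x\<^sup>2" .
      \<comment> \<open>The threshold 7056 = 16 * 21^2 is what makes this at most x^3, with
        logarithm 3 y.\<close>
      have "real (4 * (2 * b)\<^sup>2) = 16 * (real b)\<^sup>2" by (simp add: power_mult_distrib)
      also have "\<dots> \<le> 16 * (21 * x)\<^sup>2" using b by (intro mult_left_mono power_mono) auto
      also have "\<dots> = 7056 * x\<^sup>2" by (simp add: power_mult_distrib)
      also have "\<dots> \<le> x ^ 3" using x by (simp add: power2_eq_square power3_eq_cube mult_right_mono)
      finally have "ln (4 * (2 * b)\<^sup>2) \<le> ln (x ^ 3)" using b1 x by (subst ln_le_cancel_iff) auto
      also have "\<dots> = 3 * y" using x by (simp add: y_def ln_realpow)
      finally have l: "ln (4 * (2 * b)\<^sup>2) \<le> 3 * y" .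
      have "real ?n = 3 * (real b + 1)\<^sup>2" by simp
      also have "\<dots> \<le> 3 * (22 * x)\<^sup>2" using b x by (intro mult_left_mono power_mono) auto
      finally have "real ?n \<le> 1452 * x\<^sup>2" by (simp add: power_mult_distrib)
      moreover have "0 \<le> ln (real (4 * (2 * b)\<^sup>2))"
      proof -
        have "1 \<le> 4 * (2 * b)\<^sup>2" using b1 by (simp add: Suc_le_eq)
        then have "(1 :: real) \<le> real (4 * (2 * b)\<^sup>2)"
          using of_nat_mono[of 1 "4 * (2 * b)\<^sup>2", where 'a = real] by (simp only: of_nat_1)
        then show ?thesis by (rule ln_ge_zero)
      qed
      ultimately have "real ?n * ln (4 * (2 * b)\<^sup>2) \<le> (1452 * x\<^sup>2) * (3 * y)"
        using l by (intro mult_mono) simp_all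
      then have t2: "real ?n * ln (4 * (2 * b)\<^sup>2) \<le> 4356 * (x\<^sup>2 * y)" by simp
      have "6000 * (x\<^sup>2 * y) \<le> (10000 * (x\<^sup>2 * y)) * (3 / 5)" by simp
      also have "\<dots> \<le> s * ln 2" using s y ln2_ge_two_thirds by (intro mult_mono) auto
      finally have t3: "6000 * (x\<^sup>2 * y) \<le> s * ln 2" .
      have t4: "x\<^sup>2 \<le> x\<^sup>2 * y" using y mult_left_mono[of 1 y "x\<^sup>2"] by simp
      have t5: "x \<le> x\<^sup>2" using x by (simp add: power2_eq_square)
      show ?thesis unfolding exp_le_cancel_iff using t1 t2 t3 t4 t5 x by linarith
    qed
    also have "\<dots> = 1 / ?N" by (simp add: exp_minus expx inverse_eq_divide)
    finally show ?thesis .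
  qed
  finally show ?thesis by simp
qed

text \<open>At least N / 3 elements must be covered by sets of at most \<sigma> elements
  each.\<close>

lemma not_union_of_few_sumsets:
  fixes \<sigma> :: real
  assumes "S \<subseteq> carrier G" "real (card S) \<ge> card (carrier G) / 3" "\<sigma> > 0"
    and "\<And>A. A \<subseteq> carrier G \<Longrightarrow> sumset G A \<subseteq> S \<Longrightarrow> card (sumset G A) \<le> \<sigma>"
    and "union_of_sumsets G m S"
  shows "real m \<ge> card (carrier G) / (3 * \<sigma>)"
proof -
  obtain A where A: "\<forall>i<m. A i \<subseteq> carrier G" "S = (\<Union>i<m. sumset G (A i))"
    using assms(5) unfolding union_of_sumsets_def by blast
  have "card S \<le> (\<Sum>i<m. card (sumset G (A i)))" unfolding A(2) by (rule card_UN_le) simp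
  then have "real (card S) \<le> (\<Sum>i<m. real (card (sumset G (A i))))" by (metis of_nat_le_iff of_nat_sum)
  also have "\<dots> \<le> (\<Sum>i<m. \<sigma>)" using A by (intro sum_mono assms(4)) auto
  finally show ?thesis using assms(2,3) by (simp add: field_simps)
qed

text \<open>Since k <= x / 10, 2^k is at most N^(1/10), and 4^k * 72 k^4 is at most N^(2/5). The
  concentration exponent is then at least N^(3/5), which beats the exp(x^2) bound on the number of
  sets \<open>A\<close>. The same estimates verify \<open>k_small\<close>.\<close>

lemma prob_not_pseudorandom_le:
  fixes x :: real
  defines "x \<equiv> ln (card (carrier G))"
  defines "k \<equiv> nat \<lfloor>x / 10\<rfloor>"
  assumes x: "x \<ge> 7056" "72 * x ^ 4 \<le> exp (x / 5)" "x\<^sup>2 + x + 1 \<le> exp (3 * x / 5)"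
  shows "measure_pmf.prob (pmf_of_set (Pow (carrier G))) {S. \<not> pseudorandom_set G S k} \<le> 1 / card (carrier G)"
proof -
  let ?N = "card (carrier G)" and ?P = "measure_pmf.prob (pmf_of_set (Pow (carrier G)))"
  have N0: "?N > 0" by (rule card_carrier_pos)
  have expx: "exp x = ?N" using N0 by (simp add: x_def)
  have k: "real k \<le> x / 10" "k \<ge> 2" using x(1) unfolding k_def by linarith+
  have two: "(2::real) ^ k \<le> exp (x / 10)"
  proof -
    have "(2::real) ^ k \<le> exp 1 ^ k" using exp_ge_add_one_self[of 1] by (intro power_mono) auto
    also have "\<dots> = exp k" by (simp add: exp_of_nat_mult[symmetric])
    finally show ?thesis using k by (meson exp_le_cancel_iff order_trans)
  qed
  have k4: "72 * real k ^ 4 \<le> exp (x / 5)"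
  proof -
    have "real k \<le> x" using k x by linarith
    then have "72 * real k ^ 4 \<le> 72 * x ^ 4" by (intro mult_left_mono power_mono) auto
    then show ?thesis using x(2) by linarith
  qed
  have "k + k ^ 3 \<le> ?N / 2 ^ k / (12 * real k)"
  proof -
    have "k + k ^ 3 \<le> 2 * k ^ 3" using self_le_power[of k 3] k by simp
    then have "real (k + k ^ 3) \<le> real (2 * k ^ 3)" by (simp only: of_nat_le_iff)
    then have "real (k + k ^ 3) * (12 * real k) \<le> real (2 * k ^ 3) * (12 * real k)"
      by (rule mult_right_mono) simp
    also have "\<dots> = 24 * real k ^ 4" by (simp add: power3_eq_cube power4_eq_xxxx)
    also have "\<dots> \<le> 72 * real k ^ 4" by simp
    also have "\<dots> \<le> exp (x / 5)" by (rule k4)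
    finally have "real (k + k ^ 3) * (12 * real k) * 2 ^ k \<le> exp (x / 5) * exp (x / 10)"
      using two by (intro mult_mono) auto
    also have "\<dots> \<le> exp x" using x(1) unfolding exp_add[symmetric] by simp
    finally have "real (k + k ^ 3) * (12 * real k * 2 ^ k) \<le> ?N" by (simp only: expx mult.assoc)
    then have "real (k + k ^ 3) \<le> ?N / (12 * real k * 2 ^ k)" using k by (subst pos_le_divide_eq) auto
    then show ?thesis by (simp add: mult.commute)
  qed
  then have ps: "pseudorandom_set G S k"
    if "\<And>A. A \<subseteq> carrier G \<Longrightarrow> A \<noteq> {} \<Longrightarrow> card A \<le> k \<Longrightarrow>
      \<bar>card (common_nbhd S A) - ?N / 2 ^ card A\<bar> \<le> ?N / 2 ^ card A / (12 * k)" for S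
    using k that by unfold_locales auto
  have "{S. \<not> pseudorandom_set G S k} \<subseteq> {S. \<exists>A. A \<subseteq> carrier G \<and> A \<noteq> {} \<and> card A \<le> k \<and>
       \<bar>card (common_nbhd S A) - ?N / 2 ^ card A\<bar> \<ge> ?N / 2 ^ card A / (12 * k)}" (is "_ \<subseteq> ?E")
  proof (intro subsetI, rule ccontr)
    fix S assume S: "S \<in> {S. \<not> pseudorandom_set G S k}" "S \<notin> ?E"
    have "pseudorandom_set G S k"
    proof (rule ps)
      fix A assume A: "A \<subseteq> carrier G" "A \<noteq> {}" "card A \<le> k"
      show "\<bar>card (common_nbhd S A) - ?N / 2 ^ card A\<bar> \<le> ?N / 2 ^ card A / (12 * k)"
      proof (rule ccontr)
        assume "\<not> ?thesis"
        then have "\<bar>card (common_nbhd S A) - ?N / 2 ^ card A\<bar> \<ge> ?N / 2 ^ card A / (12 * k)"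
          by (rule nle_le[THEN iffD1, THEN conjunct1])
        with A have "S \<in> ?E" by blast
        with S(2) show False by (rule notE)
      qed
    qed
    then show False using S(1) by simp
  qed
  then have "?P {S. \<not> pseudorandom_set G S k} \<le> ?P ?E"
    by (intro measure_pmf.finite_measure_mono) auto
  also have "\<dots> \<le> (?N + 1) ^ k * (2 * exp (- (?N / (72 * 4 ^ k * k ^ 4))))"
    using k prob_common_nbhd_deviation_le[of k] by simp
  also have "\<dots> \<le> exp (x\<^sup>2) * (exp 1 * exp (- exp (3 * x / 5)))"
  proof (intro mult_mono)
    have "real (?N + 1) \<le> 2 * exp x" using N0 by (simp add: expx)
    also have "\<dots> \<le> exp 1 * exp x" using exp_ge_add_one_self[of 1] by (intro mult_right_mono) auto
    also have "\<dots> \<le> exp (2 * x)" unfolding exp_add[symmetric] using x by simp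
    finally have "real (?N + 1) ^ k \<le> exp (2 * x) ^ k" by (intro power_mono) auto
    also have "\<dots> = exp (k * (2 * x))" by (simp only: exp_of_nat_mult)
    also have "\<dots> \<le> exp (x\<^sup>2)"
      using mult_right_mono[OF k(1), of "2 * x"] x by (simp add: power2_eq_square)
    finally show "real ((?N + 1) ^ k) \<le> exp (x\<^sup>2)" by simp
    show "2 \<le> exp (1::real)" using exp_ge_add_one_self[of 1] by simp
    have "(4::real) ^ k = 2 ^ k * 2 ^ k" by (simp flip: power_mult_distrib)
    also have "\<dots> \<le> exp (x / 10) * exp (x / 10)" using two by (intro mult_mono) auto
    finally have "(4::real) ^ k * (72 * real k ^ 4) \<le> (exp (x / 10) * exp (x / 10)) * exp (x / 5)"
      using k4 by (intro mult_mono) auto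
    also have "\<dots> = exp (2 * x / 5)" unfolding exp_add[symmetric] by simp
    finally have "exp (3 * x / 5) * (4 ^ k * (72 * real k ^ 4)) \<le> exp (3 * x / 5) * exp (2 * x / 5)"
      by (intro mult_left_mono) auto
    also have "\<dots> = ?N" unfolding exp_add[symmetric] expx[symmetric] by simp
    finally have "exp (3 * x / 5) \<le> ?N / (4 ^ k * (72 * real k ^ 4))"
      using k by (subst pos_le_divide_eq) auto
    then show "exp (- (?N / (72 * 4 ^ k * k ^ 4))) \<le> exp (- exp (3 * x / 5))" by (simp add: mult_ac)
  qed auto
  also have "\<dots> = exp (x\<^sup>2 + 1 - exp (3 * x / 5))"
    unfolding exp_add[symmetric] by simp
  also have "\<dots> \<le> exp (- x)" unfolding exp_le_cancel_iff using x(3) by linarith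
  also have "\<dots> = 1 / ?N" by (simp add: exp_minus expx inverse_eq_divide)
  finally show ?thesis .
qed

text \<open>Both conclusions hold for every subset outside two bad events of probability at most 2 /
  N and 1 / N: a large sumset inside \<open>S\<close>, and failure of pseudorandomness.\<close>

lemma prob_number_of_sumsets:
  fixes x :: real
  defines "x \<equiv> ln (card (carrier G))"
  assumes x: "x \<ge> 7056" "72 * x ^ 4 \<le> exp (x / 5)" "x\<^sup>2 + x + 1 \<le> exp (3 * x / 5)"
  shows "measure_pmf.prob (pmf_of_set (Pow (carrier G)))
     {S. \<not> (\<exists>m. real m < 1 / 40000 * real (card (carrier G)) / (x\<^sup>2 * ln x) \<and> union_of_sumsets G m S) \<and>
         (\<exists>m. real m \<le> 20000 * real (card (carrier G)) * ln x / x\<^sup>2 \<and>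
           union_of_sumsets G m (if \<exists>g\<in>carrier G. g \<otimes> g \<noteq> \<one> then S else S - {\<one>}))}
    \<ge> 1 - 3 / card (carrier G)" (is "measure_pmf.prob _ ?good \<ge> _")
proof -
  let ?N = "card (carrier G)" and ?P = "measure_pmf.prob (pmf_of_set (Pow (carrier G)))"
  define k where "k = nat \<lfloor>x / 10\<rfloor>"
  define y where "y = ln x"
  define s where "s = nat \<lceil>10000 * x\<^sup>2 * ln x\<rceil>"
  have N0: "?N > 0" by (rule card_carrier_pos)
  have expx: "exp x = ?N" using N0 by (simp add: x_def)
  have k: "real k \<le> x / 10" "k \<ge> 2" "real k \<ge> x / 20" using x(1) unfolding k_def by linarith+
  have y: "y \<ge> 1"
  proof -
    have "exp 1 \<le> x" using x exp_le by simp
    then show ?thesis unfolding y_def using x by (subst ln_ge_iff) auto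
  qed
  have x2: "x\<^sup>2 > 0" "x\<^sup>2 \<ge> 1" using x(1) by (auto simp: one_le_power)
  have xN: "x\<^sup>2 \<le> ?N"
  proof -
    have "x\<^sup>2 \<le> exp (3 * x / 5)" using x by linarith
    also have "\<dots> \<le> exp x" using x(1) by simp
    finally show ?thesis by (simp add: expx)
  qed
  have xy: "x\<^sup>2 \<le> x\<^sup>2 * y" using y mult_left_mono[of 1 y "x\<^sup>2"] by simp
  let ?E1 = "{S. \<exists>A. A \<subseteq> carrier G \<and> sumset G A \<subseteq> S \<and> s \<le> card (sumset G A)}"
  let ?E2 = "{S. \<not> pseudorandom_set G S k}"
  have "S \<in> ?good" if S: "S \<subseteq> carrier G" and n1: "S \<notin> ?E1" and n2: "S \<notin> ?E2" for S
  proof -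
    interpret pseudorandom_set G S k using n2 by simp
    \<comment> \<open>Pseudorandomness at the singleton of the identity also yields the density of
      \<open>S\<close>: the deviation from N / 2 is at most N / 24.\<close>
    have "common_nbhd S {\<one>} = S" using S by (auto simp: common_nbhd_def)
    then have dev: "\<bar>real (card S) - ?N / 2\<bar> \<le> ?N / 2 / (12 * k)"
      using card_common_nbhd[of "{\<one>}"] k(2) by auto
    have "?N / 2 / (12 * k) \<le> ?N / 2 / 12" using k(2) by (intro divide_left_mono) auto
    then have cS: "real (card S) \<ge> ?N / 3" using dev unfolding abs_le_iff by linarith
    have s: "real s \<le> 10001 * (x\<^sup>2 * y)"
    proof -
      have "0 \<le> 10000 * x\<^sup>2 * ln x" using y by (simp add: y_def)
      then have "real s \<le> 10000 * x\<^sup>2 * ln x + 1" unfolding s_def by linarith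
      then show ?thesis using xy x2 unfolding y_def by linarith
    qed
    have lower: "\<not> real m < 1 / 40000 * ?N / (x\<^sup>2 * ln x)" if "union_of_sumsets G m S" for m
    proof -
      let ?\<sigma> = "10001 * (x\<^sup>2 * y)"
      have "card (sumset G A) \<le> ?\<sigma>" if "A \<subseteq> carrier G" "sumset G A \<subseteq> S" for A
      proof -
        have "card (sumset G A) \<le> s" using n1 that by (auto simp: not_le intro: less_imp_le)
        then show ?thesis using s by linarith
      qed
      moreover have "?\<sigma> > 0" using x2 y by simp
      ultimately have "?N / (3 * ?\<sigma>) \<le> m"
        using S cS that by (intro not_union_of_few_sumsets)
      moreover have "1 / 40000 * ?N / (x\<^sup>2 * y) \<le> ?N / (3 * ?\<sigma>)"
        using x2 y by (simp add: field_simps)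
      ultimately show ?thesis by (simp add: y_def)
    qed
    \<comment> \<open>A round covers a proportion k^2 / (20 N), so this many rounds shrink the
      remainder by exp(-2 y) = 1 / x^2.\<close>
    define r where "r = nat \<lceil>40 * ?N * y / k\<^sup>2\<rceil>"
    have k2: "real (k\<^sup>2) > 0" using k(2) by simp
    have r: "40 * ?N * y / k\<^sup>2 \<le> r" "real r \<le> 40 * ?N * y / k\<^sup>2 + 1"
    proof -
      have "0 \<le> 40 * ?N * y / k\<^sup>2" using y by simp
      then show "40 * ?N * y / k\<^sup>2 \<le> r" "real r \<le> 40 * ?N * y / k\<^sup>2 + 1" unfolding r_def by linarith+
    qed
    obtain m where m: "union_of_sumsets G m (if \<exists>g\<in>carrier G. g \<otimes> g \<noteq> \<one> then S else S - {\<one>})"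
      "real m \<le> r + exp (- (r * (k\<^sup>2 / (20 * real ?N)))) * ?N"
      using union_of_few_sumsets[OF S, of r] by blast
    have "2 * y = (40 * ?N * y / k\<^sup>2) * (k\<^sup>2 / (20 * real ?N))" using k2 carrier_not_empty by (simp add: field_simps)
    also have "\<dots> \<le> r * (k\<^sup>2 / (20 * real ?N))" using r(1) by (intro mult_right_mono) auto
    finally have "exp (- (r * (k\<^sup>2 / (20 * real ?N)))) \<le> exp (- (2 * y))" by simp
    also have "\<dots> = 1 / x\<^sup>2"
      using x(1) exp_of_nat_mult[of 2 y] by (simp add: exp_minus inverse_eq_divide y_def)
    finally have "exp (- (r * (k\<^sup>2 / (20 * real ?N)))) * ?N \<le> 1 / x\<^sup>2 * ?N"
      by (rule mult_right_mono) simp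
    then have "real m \<le> 40 * ?N * y / k\<^sup>2 + 1 + ?N / x\<^sup>2" using m(2) r(2) by simp
    also have "40 * ?N * y / k\<^sup>2 \<le> 40 * ?N * y / (x / 20)\<^sup>2"
    proof -
      have "(x / 20)\<^sup>2 \<le> (real k)\<^sup>2" using k(3) x(1) by (intro power_mono) auto
      then show ?thesis using y k2 x2 by (intro divide_left_mono) auto
    qed
    \<comment> \<open>The factor is 40 * 20^2, from k >= x / 20. The rounding of \<open>r\<close>
      and the leftover singletons each add at most N y / x^2.\<close>
    also have "\<dots> = 16000 * (?N * y / x\<^sup>2)" by (simp add: power_divide)
    also have "1 \<le> ?N * y / x\<^sup>2"
    proof -
      have "x\<^sup>2 \<le> ?N * y" using xN y mult_left_mono[of 1 y ?N] by simp
      then show ?thesis using x2 by simp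
    qed
    also have "?N / x\<^sup>2 \<le> ?N * y / x\<^sup>2"
    proof -
      have "real ?N * 1 \<le> ?N * y" using y by (intro mult_left_mono) auto
      then show ?thesis using x2 by (intro divide_right_mono) auto
    qed
    finally have "real m \<le> 16002 * (?N * y / x\<^sup>2)" by (simp add: mult_ac)
    also have "\<dots> \<le> 20000 * (?N * y / x\<^sup>2)" using y by (intro mult_right_mono) auto
    finally have "real m \<le> 20000 * real ?N * ln x / x\<^sup>2" by (simp add: y_def)
    then show ?thesis using m(1) lower by blast
  qed
  then have "Pow (carrier G) - ?good \<subseteq> ?E1 \<union> ?E2" by blast
  then have "?P (Pow (carrier G) - ?good) \<le> ?P (?E1 \<union> ?E2)"
    by (intro measure_pmf.finite_measure_mono) auto
  also have "\<dots> \<le> ?P ?E1 + ?P ?E2" by (intro measure_Un_le) auto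
  also have "?P ?E1 \<le> 2 / ?N" using prob_large_sumset_le x(1) unfolding x_def s_def by simp
  also have "?P ?E2 \<le> 1 / ?N" using prob_not_pseudorandom_le x unfolding x_def k_def by simp
  finally have bad: "?P (Pow (carrier G) - ?good) \<le> 3 / ?N" by simp
  \<comment> \<open>The bad part was bounded only among subsets of the carrier; these have full
    probability.\<close>
  have "1 = ?P (Pow (carrier G))"
    by (subst prob_random_subset) (auto simp: card_Pow simp flip: Pow_def)
  also have "\<dots> \<le> ?P (?good \<union> (Pow (carrier G) - ?good))"
    by (intro measure_pmf.finite_measure_mono) auto
  also have "\<dots> \<le> ?P ?good + ?P (Pow (carrier G) - ?good)" by (intro measure_Un_le) auto
  finally show ?thesis using bad by linarith
qed

end

section \<open>Passage to large orders\<close>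

theorem theorem7p1:
  shows "\<exists>c C :: real. c > 0 \<and> C > 0 \<and>
    (\<forall>\<epsilon>>0. \<exists>N\<^sub>0 :: nat. \<forall>(G :: nat monoid) N.
       comm_group G \<and> finite (carrier G) \<and> Coset.order G = N \<and> N \<ge> N\<^sub>0 \<longrightarrow>
       measure_pmf.prob (pmf_of_set (Pow (carrier G)))
         {S. \<not> (\<exists>m. real m < c * real N / ((ln (real N))\<^sup>2 * ln (ln (real N))) \<and>
                    union_of_sumsets G m S) \<and>
             (\<exists>m. real m \<le> C * real N * ln (ln (real N)) / (ln (real N))\<^sup>2 \<and>
                  union_of_sumsets G m
                    (if \<exists>g\<in>carrier G. g \<otimes>\<^bsub>G\<^esub> g \<noteq> \<one>\<^bsub>G\<^esub> then S else S - {\<one>\<^bsub>G\<^esub>}))}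
       \<ge> 1 - \<epsilon>)"
proof (rule exI[of _ "1 / 40000"], rule exI[of _ 20000], intro conjI allI impI)
  fix \<epsilon> :: real assume \<epsilon>: "\<epsilon> > 0"
  \<comment> \<open>All conditions concern N alone and not the group, so one threshold serves every
    group; the last condition makes the failure probability 3 / N at most \<epsilon>.\<close>
  have "\<forall>\<^sub>F N :: nat in sequentially. ln (real N) \<ge> 7056" by real_asymp
  moreover have "\<forall>\<^sub>F N :: nat in sequentially. 72 * (ln (real N)) ^ 4 \<le> exp (ln (real N) / 5)"
    by real_asymp
  moreover have "\<forall>\<^sub>F N :: nat in sequentially. (ln (real N))\<^sup>2 + ln (real N) + 1 \<le> exp (3 * ln (real N) / 5)"
    by real_asymp
  moreover have "\<forall>\<^sub>F N :: nat in sequentially. 3 / real N \<le> \<epsilon>"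
  proof -
    have "(\<lambda>N. 3 / real N) \<longlonglongrightarrow> 0" by real_asymp
    then have "\<forall>\<^sub>F N :: nat in sequentially. 3 / real N < \<epsilon>" using \<epsilon> by (rule order_tendstoD)
    then show ?thesis by eventually_elim simp
  qed
  ultimately have "\<forall>\<^sub>F N :: nat in sequentially. ln (real N) \<ge> 7056 \<and> 72 * (ln (real N)) ^ 4 \<le> exp (ln (real N) / 5) \<and>
      (ln (real N))\<^sup>2 + ln (real N) + 1 \<le> exp (3 * ln (real N) / 5) \<and> 3 / real N \<le> \<epsilon>"
    by eventually_elim auto
  then obtain N\<^sub>0 where N0: "\<And>N :: nat. N \<ge> N\<^sub>0 \<Longrightarrow> ln (real N) \<ge> 7056 \<and> 72 * (ln (real N)) ^ 4 \<le> exp (ln (real N) / 5) \<and>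
      (ln (real N))\<^sup>2 + ln (real N) + 1 \<le> exp (3 * ln (real N) / 5) \<and> 3 / real N \<le> \<epsilon>"
    unfolding eventually_sequentially by blast
  show "\<exists>N\<^sub>0 :: nat. \<forall>(G :: nat monoid) N.
       comm_group G \<and> finite (carrier G) \<and> Coset.order G = N \<and> N \<ge> N\<^sub>0 \<longrightarrow>
       measure_pmf.prob (pmf_of_set (Pow (carrier G)))
         {S. \<not> (\<exists>m. real m < 1 / 40000 * real N / ((ln (real N))\<^sup>2 * ln (ln (real N))) \<and>
                    union_of_sumsets G m S) \<and>
             (\<exists>m. real m \<le> 20000 * real N * ln (ln (real N)) / (ln (real N))\<^sup>2 \<and>
                  union_of_sumsets G m
                    (if \<exists>g\<in>carrier G. g \<otimes>\<^bsub>G\<^esub> g \<noteq> \<one>\<^bsub>G\<^esub> then S else S - {\<one>\<^bsub>G\<^esub>}))}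
       \<ge> 1 - \<epsilon>"
  proof (intro exI[of _ N\<^sub>0] allI impI, elim conjE)
    fix G :: "nat monoid" and N
    assume G: "comm_group G" "finite (carrier G)" "Coset.order G = N" "N \<ge> N\<^sub>0"
    interpret finite_comm_group G using G(1,2) by (simp add: finite_comm_group_def finite_comm_group_axioms_def)
    have N: "N = card (carrier G)" using G(3) by (simp add: Coset.order_def)
    have N0': "ln (real N) \<ge> 7056" "72 * (ln (real N)) ^ 4 \<le> exp (ln (real N) / 5)"
      "(ln (real N))\<^sup>2 + ln (real N) + 1 \<le> exp (3 * ln (real N) / 5)" "3 / real N \<le> \<epsilon>"
      using N0[OF G(4)] by auto
    have "1 - \<epsilon> \<le> 1 - 3 / real N" using N0'(4) by simp
    also note prob_number_of_sumsets[folded N, OF N0'(1-3)]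
    finally show "measure_pmf.prob (pmf_of_set (Pow (carrier G)))
         {S. \<not> (\<exists>m. real m < 1 / 40000 * real N / ((ln (real N))\<^sup>2 * ln (ln (real N))) \<and>
                    union_of_sumsets G m S) \<and>
             (\<exists>m. real m \<le> 20000 * real N * ln (ln (real N)) / (ln (real N))\<^sup>2 \<and>
                  union_of_sumsets G m
                    (if \<exists>g\<in>carrier G. g \<otimes>\<^bsub>G\<^esub> g \<noteq> \<one>\<^bsub>G\<^esub> then S else S - {\<one>\<^bsub>G\<^esub>}))}
       \<ge> 1 - \<epsilon>" .
  qed
qed simp_all

end
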